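(* For all integers $k,n\ge 1$ the punctual Hilbert scheme $\mathrm{Hilb}^k_0(\mathbb{C}^n)$ is connected.
   Context: $\mathrm{Hilb}^k(\mathbb{C}^n)$ is the Hilbert scheme of $k$ points on $\mathbb{C}^n$, parametrising ideals of colength $k$ in $\mathbb{C}[x_1,\ldots,x_n]$. The punctual Hilbert scheme $\mathrm{Hilb}^k_0(\mathbb{C}^n)\subset\mathrm{Hilb}^k(\mathbb{C}^n)$ is the closed locus of length-$k$ subschemes supported at the origin. *)

theory Defs
  imports "HOL-Analysis.Analysis" "HOL-Library.Poly_Mapping"
begin

section \<open>Polynomials over the complex numbers\<close>

text \<open>
  Polynomials with complex coefficients in variables indexed by \<^typ>\<open>'v\<close>, as finitely supported
  functions from exponent vectors to coefficients. For \<^typ>\<open>'n::finite\<close> the type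
  \<open>'n mpoly\<close> is the ring C[x_1,...,x_n] with n = CARD('n); every n \<ge> 1 arises.
\<close>

type_synonym 'v mpoly = "('v \<Rightarrow>\<^sub>0 nat) \<Rightarrow>\<^sub>0 complex"

definition const_poly :: "complex \<Rightarrow> 'v mpoly" where
  "const_poly c = Poly_Mapping.single 0 c"

definition mon :: "('v \<Rightarrow>\<^sub>0 nat) \<Rightarrow> 'v mpoly" where
  "mon m = Poly_Mapping.single m 1"

definition eval_poly :: "('v \<Rightarrow> complex) \<Rightarrow> 'v mpoly \<Rightarrow> complex" where
  "eval_poly a f =
     (\<Sum>m\<in>Poly_Mapping.keys f. Poly_Mapping.lookup f m *
        (\<Prod>v\<in>Poly_Mapping.keys m. a v ^ Poly_Mapping.lookup m v))"

section \<open>Ideals of finite colength\<close>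

text \<open>An ideal is a submodule of the ring regarded as a module over itself.\<close>

definition is_ideal :: "'a::comm_ring_1 set \<Rightarrow> bool" where
  "is_ideal I \<longleftrightarrow> module.subspace (*) I"

text \<open>The residue classes of the elements of \<open>B\<close> are pairwise distinct and form a basis of the
  complex vector space C[x]/I.\<close>

definition basis_mod :: "'v mpoly set \<Rightarrow> 'v mpoly set \<Rightarrow> bool" where
  "basis_mod I B \<longleftrightarrow>
     finite B \<and>
     (\<forall>f. \<exists>!a. (\<forall>b. b \<notin> B \<longrightarrow> a b = 0) \<and> f - (\<Sum>b\<in>B. const_poly (a b) * b) \<in> I)"

definition has_colength :: "'v mpoly set \<Rightarrow> nat \<Rightarrow> bool" where
  "has_colength I k \<longleftrightarrow> (\<exists>B. basis_mod I B \<and> card B = k)"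

definition zero_locus :: "'v mpoly set \<Rightarrow> ('v \<Rightarrow> complex) set" where
  "zero_locus I = {a. \<forall>f\<in>I. eval_poly a f = 0}"

section \<open>The Hilbert scheme of points: closed points and their Zariski topology\<close>

definition hilb :: "nat \<Rightarrow> 'n::finite mpoly set set" where
  "hilb k = {I. is_ideal I \<and> has_colength I k}"

definition punctual_hilb :: "nat \<Rightarrow> 'n::finite mpoly set set" where
  "punctual_hilb k = {I \<in> hilb k. zero_locus I = {\<lambda>_. 0}}"

text \<open>
  The Hilbert scheme is covered by the affine open subschemes \<open>U_B\<close>, one for each set \<open>B\<close> of \<open>k\<close>
  monomials, where \<open>U_B\<close> consists of the ideals \<open>I\<close> for which \<open>B\<close> is a basis of C[x]/I.
  The coordinate ring of \<open>U_B\<close> is generated by the functions \<open>c_{m,b}\<close> (\<open>m\<close> a monomial,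
  \<open>b \<in> B\<close>) given by the expansions \<open>x^m = \<Sum>b\<in>B. c_{m,b}(I) x^b\<close> modulo \<open>I\<close>
  (see Haiman, ``t,q-Catalan numbers and the Hilbert scheme'', Section 2).
  Below, \<open>B\<close> is given by the set of exponent vectors.
\<close>

definition chart :: "nat \<Rightarrow> ('n::finite \<Rightarrow>\<^sub>0 nat) set \<Rightarrow> 'n mpoly set set" where
  "chart k B = {I \<in> hilb k. basis_mod I (mon ` B)}"

definition chart_coord ::
  "('n::finite \<Rightarrow>\<^sub>0 nat) set \<Rightarrow> 'n mpoly set \<Rightarrow> ('n \<Rightarrow>\<^sub>0 nat) \<times> ('n \<Rightarrow>\<^sub>0 nat) \<Rightarrow> complex" where
  "chart_coord B I = (\<lambda>(m, b).
     (THE a. (\<forall>p. p \<notin> mon ` B \<longrightarrow> a p = 0) \<and>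
             mon m - (\<Sum>p\<in>mon ` B. const_poly (a p) * p) \<in> I) (mon b))"

text \<open>
  The topology generated by the principal open subsets of the charts. The regular functions on a
  chart are the polynomials in the (infinitely many) functions \<open>c_{m,b}\<close>; overlaps of charts are
  principal open in either chart and the transition functions are regular there, so that this
  topology induces the Zariski topology on each chart.
\<close>

definition hilb_zariski :: "nat \<Rightarrow> 'n::finite mpoly set topology" where
  "hilb_zariski k = topology_generated_by
     {{I \<in> chart k B. eval_poly (chart_coord B I) P \<noteq> 0} | B P. finite B \<and> card B = k}"

section \<open>All points of the scheme\<close>

definition irreducible_closedin :: "'a topology \<Rightarrow> 'a set \<Rightarrow> bool" where
  "irreducible_closedin X Y \<longleftrightarrow>
     closedin X Y \<and> Y \<noteq> {} \<and>
     (\<forall>A B. closedin X A \<and> closedin X B \<and> Y \<subseteq> A \<union> B \<longrightarrow> Y \<subseteq> A \<or> Y \<subseteq> B)"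

text \<open>
  The underlying space of a scheme locally of finite type over an algebraically closed field is
  recovered from the space \<open>X\<close> of its closed points: the points of the scheme correspond to the
  irreducible closed subsets of \<open>X\<close> (a closed point \<open>x\<close> to \<open>{x}\<close>), and the open sets of the scheme
  to the open sets of \<open>X\<close> (Hartshorne, Algebraic Geometry, Proposition II.2.6). Nilpotents in the
  structure sheaf do not affect the underlying space.
\<close>

definition scheme_space :: "'a topology \<Rightarrow> 'a set topology" where
  "scheme_space X = topology_generated_by
     {{Y. irreducible_closedin X Y \<and> Y \<inter> U \<noteq> {}} | U. openin X U}"

definition punctual_hilbert_scheme :: "nat \<Rightarrow> 'n::finite mpoly set set topology" where
  "punctual_hilbert_scheme k = scheme_space (subtopology (hilb_zariski k) (punctual_hilb k))"

end

theory Submission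
  imports Defs "HOL-Computational_Algebra.Fundamental_Theorem_Algebra"
begin

text \<open>
  Write m for the maximal ideal of the origin. Call J a hyperplane in I if J has codimension one in I,
  and call two punctual ideals of colength k adjacent if both are hyperplanes in a common subspace.
  Two facts give the connectedness.

  First, any two punctual ideals of colength k are joined by a chain of adjacent ones
  (\<open>adjacent_chain\<close>, by induction on k). For k = 1 there is only m. In general, the variables have a
  joint eigenvector in the nonzero space m/I, so every punctual I of colength k + 1 is a hyperplane
  in a punctual ideal I' of colength k (\<open>exists_punctual_containing\<close>). If J is another such ideal,
  in J', join I' and J' by a chain. If K and K' are distinct neighbours in the chain, then
  K \<inter> K' has codimension one in both, hence colength k + 1, and it is supported at the origin because
  it contains the products K K'. Two ideals of colength k + 1 that are hyperplanes in the same K are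
  adjacent, so the intersections of consecutive members of the chain, together with I and J,
  form the required chain.

  Second, adjacent ideals I and J lie on an affine line in the punctual Hilbert scheme
  (\<open>adjacent_pencil\<close>). With L = I \<inter> J, I = L + C f and J = L + C g the line consists of the ideals
  I_t = L + C ((1 - t) f + t g). These are ideals because every h multiplies f and g into
  h(0) f + L and h(0) g + L: an eigenvalue of the variables on I/L or J/L is a common zero of L,
  so it is 0. The map t \<mapsto> I_t is continuous for the cofinite topology on the parameters
  (\<open>pencil_continuous\<close>). Indeed, if the monomials in B form a basis modulo one member of the line,
  which may be taken to be t = 0, then they do so modulo I_t for all but at most one t, and the
  coordinates of I_t are polynomials in s = t / (1 + \<nu> t) with \<nu> constant. Two nonempty cofinite sets
  of parameters meet, so a separation of the punctual Hilbert scheme cannot separate I from J.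

  What remains is topology: the map from closed points to points of the scheme is continuous with
  dense image (\<open>connected_scheme_space\<close>), and multiple points on a coordinate axis
  show that there is something to connect.

  Dimensions of quotients are handled through exchange of basis elements (\<open>basis_mod_insert\<close>,
  \<open>basis_mod_remove\<close>), which at the same time yields the monomial bases that put every ideal into a
  chart.
\<close>

section \<open>Evaluation of polynomials\<close>

abbreviation var :: "'v \<Rightarrow> 'v mpoly" where
  "var v \<equiv> mon (Poly_Mapping.single v 1)"

lemma const_poly_0 [simp]: "const_poly 0 = 0"
  and const_poly_1 [simp]: "const_poly 1 = 1"
  and const_poly_add: "const_poly (a + b) = const_poly a + const_poly b"
  and const_poly_diff: "const_poly (a - b) = const_poly a - const_poly b"
  and const_poly_uminus: "const_poly (- a) = - const_poly a"
  and const_poly_mult: "const_poly (a * b) = const_poly a * const_poly b"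
  by (simp_all add: const_poly_def single_add single_diff single_uminus mult_single)

lemmas const_poly_simps = const_poly_add const_poly_diff const_poly_uminus const_poly_mult

lemma poly_mapping_add_single_induct [case_names zero add]:
  fixes f :: "'a \<Rightarrow>\<^sub>0 'b::comm_monoid_add"
  assumes "P 0" and "\<And>f a b. P f \<Longrightarrow> P (Poly_Mapping.single a b + f)"
  shows "P f"
proof (induction f rule: update_induct)
  case const
  show ?case by fact
next
  case (update f a b)
  have "Poly_Mapping.update a b f = Poly_Mapping.single a b + f"
    using update.hyps(1)
    by (intro poly_mapping_eqI)
       (auto simp: lookup_update lookup_add lookup_single when_def in_keys_iff)
  then show ?case
    using assms(2) update.IH by simp
qed

text \<open>Constants and variables generate the polynomial ring. In this form, a property of evaluation at a
  point only has to be checked for the variables, as in \<open>acts_by_evaluation\<close>.\<close>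

lemma mpoly_induct [case_names const var add mult]:
  fixes f :: "'v mpoly"
  assumes const: "\<And>c. P (const_poly c)" and var: "\<And>v. P (var v)"
    and add: "\<And>f g. P f \<Longrightarrow> P g \<Longrightarrow> P (f + g)" and mult: "\<And>f g. P f \<Longrightarrow> P g \<Longrightarrow> P (f * g)"
  shows "P f"
proof (induction f rule: poly_mapping_add_single_induct)
  case zero
  show ?case using const[of 0] by simp
next
  case (add f m c)
  have pow: "P (mon (Poly_Mapping.single v j))" for v j
  proof (induction j)
    case 0
    show ?case using const[of 1] by (simp add: mon_def)
  next
    case (Suc j)
    have "mon (Poly_Mapping.single v (Suc j)) = var v * mon (Poly_Mapping.single v j)"
      by (simp add: mon_def mult_single flip: single_add)
    then show ?case using mult var Suc by metis
  qed
  have "P (mon m)"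
  proof (induction m rule: poly_mapping_add_single_induct)
    case zero
    show ?case using const[of 1] by (simp add: mon_def)
  next
    case (add m v j)
    have "mon (Poly_Mapping.single v j + m) = mon (Poly_Mapping.single v j) * mon m"
      by (simp add: mon_def mult_single)
    then show ?case using mult pow add by metis
  qed
  moreover have "Poly_Mapping.single m c = const_poly c * mon m"
    by (simp add: const_poly_def mon_def mult_single)
  ultimately show ?case
    using assms(3) mult const add by metis
qed

lemma eval_poly_superset:
  assumes "finite S" "Poly_Mapping.keys f \<subseteq> S"
  shows "eval_poly a f = (\<Sum>m\<in>S. Poly_Mapping.lookup f m *
           (\<Prod>v\<in>Poly_Mapping.keys m. a v ^ Poly_Mapping.lookup m v))"
  unfolding eval_poly_def by (rule sum.mono_neutral_left) (use assms in \<open>auto simp: in_keys_iff\<close>)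

lemma eval_poly_add [simp]: "eval_poly a (f + g) = eval_poly a f + eval_poly a g"
proof -
  let ?S = "Poly_Mapping.keys f \<union> Poly_Mapping.keys g"
  have "eval_poly a h = (\<Sum>m\<in>?S. Poly_Mapping.lookup h m *
           (\<Prod>v\<in>Poly_Mapping.keys m. a v ^ Poly_Mapping.lookup m v))"
    if "h \<in> {f, g, f + g}" for h
    using that keys_add[of f g] by (intro eval_poly_superset) auto
  then show ?thesis
    by (simp add: lookup_add algebra_simps sum.distrib)
qed

lemma eval_poly_single:
  "eval_poly a (Poly_Mapping.single m c) =
     c * (\<Prod>v\<in>Poly_Mapping.keys m. a v ^ Poly_Mapping.lookup m v)"
  by (subst eval_poly_superset[of "{m}"]) auto

lemma eval_poly_const [simp]: "eval_poly a (const_poly c) = c"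
  by (simp add: const_poly_def eval_poly_single)

lemma eval_poly_0 [simp]: "eval_poly a 0 = 0"
  and eval_poly_1 [simp]: "eval_poly a 1 = 1"
  using eval_poly_const[of a 0] eval_poly_const[of a 1] by simp_all

lemma eval_poly_mon_single [simp]: "eval_poly a (mon (Poly_Mapping.single v j)) = a v ^ j"
  by (cases "j = 0") (simp_all add: mon_def eval_poly_single)

lemma eval_poly_mult [simp]: "eval_poly a (f * g) = eval_poly a f * eval_poly a g"
proof (induction f rule: poly_mapping_add_single_induct)
  case zero
  show ?case by simp
next
  case (add f m c)
  have exponents: "(\<Prod>v\<in>Poly_Mapping.keys (m + m'). a v ^ Poly_Mapping.lookup (m + m') v) =
     (\<Prod>v\<in>Poly_Mapping.keys m. a v ^ Poly_Mapping.lookup m v) *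
     (\<Prod>v\<in>Poly_Mapping.keys m'. a v ^ Poly_Mapping.lookup m' v)" for m'
  proof -
    let ?S = "Poly_Mapping.keys m \<union> Poly_Mapping.keys m'"
    have superset: "(\<Prod>v\<in>Poly_Mapping.keys p. a v ^ Poly_Mapping.lookup p v) =
          (\<Prod>v\<in>?S. a v ^ Poly_Mapping.lookup p v)" if "p \<in> {m, m', m + m'}" for p
      using that keys_add[of m m'] by (intro prod.mono_neutral_left) (auto simp: in_keys_iff)
    show ?thesis
      unfolding superset[of m, simplified] superset[of m', simplified]
        superset[of "m + m'", simplified]
      by (simp add: lookup_add power_add prod.distrib)
  qed
  have "eval_poly a (Poly_Mapping.single m c * g) =
        eval_poly a (Poly_Mapping.single m c) * eval_poly a g"
    by (induction g rule: poly_mapping_add_single_induct)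
       (simp_all add: mult_single eval_poly_single exponents distrib_left mult.left_commute mult.assoc)
  then show ?case
    using add by (simp add: algebra_simps)
qed

lemma eval_poly_diff [simp]: "eval_poly a (f - g) = eval_poly a f - eval_poly a g"
  using eval_poly_add[of a "f - g" g] by simp

lemma eval_poly_sum [simp]: "eval_poly a (\<Sum>i\<in>S. f i) = (\<Sum>i\<in>S. eval_poly a (f i))"
  by (induction S rule: infinite_finite_induct) auto

text \<open>Restricted to a polynomial curve, a polynomial becomes a polynomial in the parameter. For the
  coordinates along a pencil, this leaves finitely many bad parameters; for a coordinate axis, it
  describes the restriction of polynomials to the axis.\<close>

lemma eval_poly_along_curve:
  "\<exists>q. \<forall>u. eval_poly (\<lambda>v. poly (A v) u) f = poly q u"
proof
  show "\<forall>u. eval_poly (\<lambda>v. poly (A v) u) f =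
    poly (\<Sum>m\<in>Poly_Mapping.keys f. smult (Poly_Mapping.lookup f m)
            (\<Prod>v\<in>Poly_Mapping.keys m. A v ^ Poly_Mapping.lookup m v)) u"
    by (simp add: eval_poly_def poly_sum poly_prod)
qed

section \<open>Bases modulo a subspace\<close>

definition csubspace :: "'v mpoly set \<Rightarrow> bool" where
  "csubspace L \<longleftrightarrow> 0 \<in> L \<and> (\<forall>f\<in>L. \<forall>g\<in>L. f + g \<in> L) \<and> (\<forall>c. \<forall>f\<in>L. const_poly c * f \<in> L)"

lemma csubspace_0: "csubspace L \<Longrightarrow> 0 \<in> L"
  and csubspace_add: "csubspace L \<Longrightarrow> f \<in> L \<Longrightarrow> g \<in> L \<Longrightarrow> f + g \<in> L"
  and csubspace_scale: "csubspace L \<Longrightarrow> f \<in> L \<Longrightarrow> const_poly c * f \<in> L"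
  by (auto simp: csubspace_def)

lemma csubspace_uminus: "csubspace L \<Longrightarrow> f \<in> L \<Longrightarrow> - f \<in> L"
  using csubspace_scale[of L f "- 1"] by (simp add: const_poly_simps)

lemma csubspace_diff: "csubspace L \<Longrightarrow> f \<in> L \<Longrightarrow> g \<in> L \<Longrightarrow> f - g \<in> L"
  using csubspace_add[of L f "- g"] csubspace_uminus[of L g] by simp

lemma csubspace_scale_cancel:
  fixes L :: "'v mpoly set"
  assumes "csubspace L" "const_poly c * f \<in> L" "c \<noteq> 0"
  shows "f \<in> L"
proof -
  have "const_poly (inverse c) * (const_poly c * f) \<in> L"
    using assms(1,2) by (rule csubspace_scale)
  moreover have "const_poly (inverse c) * const_poly c = (1 :: 'v mpoly)"
    using assms(3) by (simp flip: const_poly_mult)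
  then have "const_poly (inverse c) * (const_poly c * f) = f"
    by (simp only: mult.assoc[symmetric] mult_1_left)
  ultimately show ?thesis by simp
qed

lemma is_ideal_iff:
  "is_ideal I \<longleftrightarrow> 0 \<in> I \<and> (\<forall>f\<in>I. \<forall>g\<in>I. f + g \<in> I) \<and> (\<forall>h. \<forall>f\<in>I. h * f \<in> I)"
proof -
  have "module ((*) :: 'a \<Rightarrow> 'a \<Rightarrow> 'a)"
    by unfold_locales (simp_all add: algebra_simps)
  then show ?thesis
    unfolding is_ideal_def by (simp add: module.subspace_def)
qed

lemma is_ideal_mult: "is_ideal I \<Longrightarrow> f \<in> I \<Longrightarrow> h * f \<in> I"
  by (simp add: is_ideal_iff)

lemma is_ideal_csubspace: "is_ideal I \<Longrightarrow> csubspace I"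
  by (simp add: is_ideal_iff csubspace_def)

definition lincomb :: "'v mpoly set \<Rightarrow> ('v mpoly \<Rightarrow> complex) \<Rightarrow> 'v mpoly" where
  "lincomb B a = (\<Sum>b\<in>B. const_poly (a b) * b)"

lemma lincomb_add: "lincomb B (\<lambda>b. a b + a' b) = lincomb B a + lincomb B a'"
  by (simp add: lincomb_def const_poly_simps algebra_simps sum.distrib)

lemma lincomb_diff: "lincomb B (\<lambda>b. a b - a' b) = lincomb B a - lincomb B a'"
  by (simp add: lincomb_def const_poly_simps algebra_simps sum_subtractf)

lemma lincomb_scale: "lincomb B (\<lambda>b. c * a b) = const_poly c * lincomb B a"
  by (simp add: lincomb_def const_poly_simps algebra_simps sum_distrib_left)

lemma lincomb_cong: "(\<And>b. b \<in> B \<Longrightarrow> a b = a' b) \<Longrightarrow> lincomb B a = lincomb B a'"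
  by (simp add: lincomb_def)

lemma lincomb_indicator:
  "finite B \<Longrightarrow> b \<in> B \<Longrightarrow> lincomb B (\<lambda>b'. if b' = b then 1 else 0) = b"
  by (simp add: lincomb_def if_distrib[of const_poly] if_distrib[of "\<lambda>x. x * _"] cong: if_cong)

lemma lincomb_insert:
  "finite B \<Longrightarrow> f \<notin> B \<Longrightarrow> lincomb (insert f B) a = const_poly (a f) * f + lincomb B a"
  by (simp add: lincomb_def)

lemma lincomb_remove:
  "finite B \<Longrightarrow> b \<in> B \<Longrightarrow> lincomb B a = const_poly (a b) * b + lincomb (B - {b}) a"
  by (simp add: lincomb_def sum.remove)

text \<open>Splitting the unique existence of coordinates into spanning and independence, where coefficient
  functions may take any values outside the basis.\<close>

lemma basis_mod_iff:
  assumes "csubspace I"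
  shows "basis_mod I B \<longleftrightarrow>
    finite B \<and> (\<forall>f. \<exists>a. f - lincomb B a \<in> I) \<and> (\<forall>a. lincomb B a \<in> I \<longrightarrow> (\<forall>b\<in>B. a b = 0))"
    (is "_ \<longleftrightarrow> ?rhs")
proof
  assume basis: "basis_mod I B"
  have "\<forall>b\<in>B. a b = 0" if a: "lincomb B a \<in> I" for a
  proof -
    let ?a = "\<lambda>b. if b \<in> B then a b else 0"
    have "\<exists>!a. (\<forall>b. b \<notin> B \<longrightarrow> a b = 0) \<and> 0 - lincomb B a \<in> I"
      using basis unfolding basis_mod_def lincomb_def by blast
    then obtain z where uniq: "\<And>a. \<forall>b. b \<notin> B \<longrightarrow> a b = 0 \<Longrightarrow> 0 - lincomb B a \<in> I \<Longrightarrow> a = z"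
      by (elim ex1E) blast
    have "lincomb B ?a = lincomb B a"
      by (rule lincomb_cong) simp
    then have "0 - lincomb B ?a \<in> I"
      using csubspace_uminus[OF assms a] by simp
    moreover have "0 - lincomb B (\<lambda>_. 0) \<in> I"
      using csubspace_0[OF assms] by (simp add: lincomb_def)
    ultimately have "?a = (\<lambda>_. 0)"
      using uniq[of ?a] uniq[of "\<lambda>_. 0"] by simp
    then show ?thesis
      by metis
  qed
  then show ?rhs
    using basis unfolding basis_mod_def lincomb_def by blast
next
  assume rhs: ?rhs
  have "\<exists>!a. (\<forall>b. b \<notin> B \<longrightarrow> a b = 0) \<and> f - lincomb B a \<in> I" for f
  proof (rule ex_ex1I)
    obtain a where a: "f - lincomb B a \<in> I"
      using rhs by blast
    have "lincomb B (\<lambda>b. if b \<in> B then a b else 0) = lincomb B a"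
      by (rule lincomb_cong) simp
    with a have "f - lincomb B (\<lambda>b. if b \<in> B then a b else 0) \<in> I"
      by simp
    then show "\<exists>a. (\<forall>b. b \<notin> B \<longrightarrow> a b = 0) \<and> f - lincomb B a \<in> I"
      by (intro exI[of _ "\<lambda>b. if b \<in> B then a b else 0"]) simp
  next
    fix a a'
    assume a: "(\<forall>b. b \<notin> B \<longrightarrow> a b = 0) \<and> f - lincomb B a \<in> I"
      and a': "(\<forall>b. b \<notin> B \<longrightarrow> a' b = 0) \<and> f - lincomb B a' \<in> I"
    have "(f - lincomb B a') - (f - lincomb B a) \<in> I"
      using csubspace_diff[OF assms conjunct2[OF a'] conjunct2[OF a]] .
    then have "lincomb B (\<lambda>b. a b - a' b) \<in> I"
      by (simp add: lincomb_diff)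
    then have "\<forall>b\<in>B. a b = a' b"
      using rhs by fastforce
    then show "a = a'"
      using a a' by (intro ext) metis
  qed
  then show "basis_mod I B"
    using rhs unfolding basis_mod_def lincomb_def by blast
qed

lemma basis_mod_finite: "basis_mod I B \<Longrightarrow> finite B"
  by (simp add: basis_mod_def)

lemma basis_mod_coords:
  assumes "csubspace I" "basis_mod I B"
  obtains a where "f - lincomb B a \<in> I"
  using assms by (meson basis_mod_iff)

lemma basis_mod_independent:
  assumes "csubspace I" "basis_mod I B" "lincomb B a \<in> I" "b \<in> B"
  shows "a b = 0"
  using assms by (simp add: basis_mod_iff)

definition add_line :: "'v mpoly set \<Rightarrow> 'v mpoly \<Rightarrow> 'v mpoly set" where
  "add_line L f = {l + const_poly c * f | l c. l \<in> L}"

lemma mem_add_line_iff: "g \<in> add_line L f \<longleftrightarrow> (\<exists>c. g - const_poly c * f \<in> L)"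
proof
  assume "g \<in> add_line L f"
  then obtain l c where "g = l + const_poly c * f" "l \<in> L"
    unfolding add_line_def by blast
  then have "g - const_poly c * f \<in> L" by simp
  then show "\<exists>c. g - const_poly c * f \<in> L" ..
next
  assume "\<exists>c. g - const_poly c * f \<in> L"
  then obtain c where c: "g - const_poly c * f \<in> L" ..
  have "g = (g - const_poly c * f) + const_poly c * f" by simp
  with c show "g \<in> add_line L f"
    unfolding add_line_def by blast
qed

lemma add_line_superset: "L \<subseteq> add_line L f"
proof
  fix g assume "g \<in> L"
  then have "g - const_poly 0 * f \<in> L" by simp
  then show "g \<in> add_line L f"
    unfolding mem_add_line_iff ..
qed

lemma add_line_self: "csubspace L \<Longrightarrow> f \<in> add_line L f"
  using csubspace_0 by (auto simp: mem_add_line_iff intro!: exI[of _ 1])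

lemma csubspace_add_line:
  assumes "csubspace L"
  shows "csubspace (add_line L f)"
proof -
  have "g + h \<in> add_line L f" if gh: "g \<in> add_line L f" "h \<in> add_line L f" for g h
  proof -
    obtain c d where c: "g - const_poly c * f \<in> L" and d: "h - const_poly d * f \<in> L"
      using gh by (auto simp: mem_add_line_iff)
    have "(g + h) - const_poly (c + d) * f \<in> L"
      using csubspace_add[OF assms c d] by (simp add: const_poly_simps algebra_simps)
    then show ?thesis by (auto simp: mem_add_line_iff)
  qed
  moreover have "const_poly d * g \<in> add_line L f" if g: "g \<in> add_line L f" for d g
  proof -
    obtain c where c: "g - const_poly c * f \<in> L"
      using g by (auto simp: mem_add_line_iff)
    have "const_poly d * g - const_poly (d * c) * f \<in> L"
      using csubspace_scale[OF assms c, of d] by (simp add: const_poly_simps algebra_simps)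
    then show ?thesis by (auto simp: mem_add_line_iff)
  qed
  moreover have "0 \<in> add_line L f"
    using csubspace_0[OF assms] add_line_superset by blast
  ultimately show ?thesis
    by (simp add: csubspace_def)
qed

text \<open>Passing to a smaller subspace: if f spans (L + C f)/L, then f completes a basis modulo
  L + C f to a basis modulo L.\<close>

lemma basis_mod_insert:
  assumes L: "csubspace L" and f: "f \<notin> L" and basis: "basis_mod (add_line L f) B"
  shows "f \<notin> B" and "basis_mod L (insert f B)"
proof -
  note Lf = csubspace_add_line[OF L, of f]
  note fin = basis_mod_finite[OF basis]
  show notin: "f \<notin> B"
  proof
    assume "f \<in> B"
    then have "lincomb B (\<lambda>b. if b = f then 1 else 0) \<in> add_line L f"
      using add_line_self[OF L] fin by (simp add: lincomb_indicator)
    from basis_mod_independent[OF Lf basis this \<open>f \<in> B\<close>] show False by simp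
  qed
  have "\<exists>a. p - lincomb (insert f B) a \<in> L" for p
  proof -
    obtain a where "p - lincomb B a \<in> add_line L f"
      using basis_mod_coords[OF Lf basis] .
    then obtain c where c: "p - lincomb B a - const_poly c * f \<in> L"
      by (auto simp: mem_add_line_iff)
    have "lincomb B (a(f := c)) = lincomb B a"
      by (rule lincomb_cong) (use notin in auto)
    then have "p - lincomb (insert f B) (a(f := c)) \<in> L"
      using c fin notin by (simp add: lincomb_insert algebra_simps)
    then show ?thesis by blast
  qed
  moreover have "\<forall>b\<in>insert f B. a b = 0" if a: "lincomb (insert f B) a \<in> L" for a
  proof -
    have sum: "lincomb B a - const_poly (- a f) * f \<in> L"
      using a fin notin by (simp add: lincomb_insert const_poly_simps algebra_simps)
    then have "lincomb B a \<in> add_line L f"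
      by (auto simp: mem_add_line_iff)
    then have zero: "\<forall>b\<in>B. a b = 0"
      using basis_mod_independent[OF Lf basis] by blast
    then have "lincomb B a = 0"
      by (simp add: lincomb_def)
    with sum have "const_poly (a f) * f \<in> L"
      by (simp add: const_poly_simps)
    then have "a f = 0"
      using csubspace_scale_cancel[OF L] f by blast
    with zero show ?thesis by simp
  qed
  ultimately show "basis_mod L (insert f B)"
    using fin by (simp add: basis_mod_iff[OF L])
qed

text \<open>Passing to a larger subspace: modulo L + C f, any basis element that occurs in the expansion of f
  is a combination of the others.\<close>

lemma basis_mod_remove:
  assumes L: "csubspace L" and basis: "basis_mod L B"
    and f: "f - lincomb B \<beta> \<in> L" and b: "b \<in> B" "\<beta> b \<noteq> 0"
  shows "basis_mod (add_line L f) (B - {b})"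
proof -
  note fin = basis_mod_finite[OF basis]
  have "\<exists>a. p - lincomb (B - {b}) a \<in> add_line L f" for p
  proof -
    obtain a where a: "p - lincomb B a \<in> L"
      using basis_mod_coords[OF L basis] .
    define c where "c = a b / \<beta> b"
    have eq: "lincomb B (\<lambda>b. a b - c * \<beta> b) = lincomb (B - {b}) (\<lambda>b. a b - c * \<beta> b)"
      using b fin by (subst lincomb_remove[of _ b]) (auto simp: c_def)
    have "(p - lincomb B a) - const_poly c * (f - lincomb B \<beta>) \<in> L"
      by (intro csubspace_diff[OF L a] csubspace_scale[OF L f])
    then have "p - lincomb B (\<lambda>b. a b - c * \<beta> b) - const_poly c * f \<in> L"
      by (simp add: lincomb_diff lincomb_scale algebra_simps)
    then have "p - lincomb (B - {b}) (\<lambda>b. a b - c * \<beta> b) - const_poly c * f \<in> L"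
      by (simp only: eq)
    then show ?thesis
      by (auto simp: mem_add_line_iff)
  qed
  moreover have "\<forall>b'\<in>B - {b}. a b' = 0" if "lincomb (B - {b}) a \<in> add_line L f" for a
  proof -
    obtain c where c: "lincomb (B - {b}) a - const_poly c * f \<in> L"
      using \<open>lincomb (B - {b}) a \<in> add_line L f\<close> by (auto simp: mem_add_line_iff)
    let ?a = "a(b := 0)"
    have "lincomb (B - {b}) a = lincomb (B - {b}) ?a"
      by (rule lincomb_cong) auto
    also have "\<dots> = lincomb B ?a"
      using fin b by (simp add: lincomb_remove[of B b])
    finally have "(lincomb B ?a - const_poly c * f) + const_poly c * (f - lincomb B \<beta>) \<in> L"
      using c by (intro csubspace_add[OF L _ csubspace_scale[OF L f]]) simp
    then have "lincomb B (\<lambda>b. ?a b - c * \<beta> b) \<in> L"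
      by (simp add: lincomb_diff lincomb_scale algebra_simps del: fun_upd_apply)
    then have zero: "?a b' - c * \<beta> b' = 0" if "b' \<in> B" for b'
      using basis_mod_independent[OF L basis] that by blast
    from zero[OF b(1)] b(2) have "c = 0" by simp
    show ?thesis
    proof
      fix b' assume "b' \<in> B - {b}"
      with zero[of b'] \<open>c = 0\<close> show "a b' = 0" by simp
    qed
  qed
  ultimately show ?thesis
    using fin by (simp add: basis_mod_iff[OF csubspace_add_line[OF L]])
qed

lemma basis_mod_coord_nonzero:
  assumes "csubspace L" "f - lincomb B \<beta> \<in> L" "f \<notin> L"
  shows "\<exists>b\<in>B. \<beta> b \<noteq> 0"
proof (rule ccontr)
  assume "\<not> ?thesis"
  then have "lincomb B \<beta> = 0"
    by (simp add: lincomb_def)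
  with assms show False by simp
qed

text \<open>Steinitz exchange, obtained by going up to L + C f and down again.\<close>

lemma basis_mod_exchange:
  assumes L: "csubspace L" and basis: "basis_mod L B"
    and f: "f - lincomb B \<beta> \<in> L" and b: "b \<in> B" "\<beta> b \<noteq> 0"
  shows "f \<notin> B - {b}" and "basis_mod L (insert f (B - {b}))"
proof -
  have "f \<notin> L"
  proof
    assume "f \<in> L"
    from csubspace_diff[OF L this f] show False
      using basis_mod_independent[OF L basis, of \<beta> b] b by simp
  qed
  then show "f \<notin> B - {b}" and "basis_mod L (insert f (B - {b}))"
    using basis_mod_insert[OF L _ basis_mod_remove[OF assms]] by simp_all
qed

text \<open>More elements than the colength are linearly dependent modulo I. If the last one is not in I itself,
  adjoining it to I lowers the colength by one, and a relation among the others modulo the larger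
  subspace can be completed to one modulo I.\<close>

lemma dependent_mod:
  assumes "csubspace I" "basis_mod I B"
  shows "\<exists>c. (\<exists>j\<le>card B. c j \<noteq> 0) \<and> (\<Sum>j\<le>card B. const_poly (c j) * F j) \<in> I"
  using assms
proof (induction "card B" arbitrary: I B)
  case 0
  then have "B = {}"
    using basis_mod_finite by fastforce
  obtain a where "F 0 - lincomb B a \<in> I"
    using basis_mod_coords[OF 0(2,3)] .
  then have "F 0 \<in> I"
    using \<open>B = {}\<close> by (simp add: lincomb_def)
  then show ?case
    using \<open>B = {}\<close> by (intro exI[of _ "\<lambda>_. 1"]) simp
next
  case (Suc n)
  note fin = basis_mod_finite[OF Suc.prems(2)]
  show ?case
  proof (cases "F (Suc n) \<in> I")
    case True
    have "(\<Sum>j\<le>card B. const_poly (if j = Suc n then 1 else 0) * F j) = F (Suc n)"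
      unfolding Suc.hyps(2)[symmetric]
      by (simp add: if_distrib[of const_poly] if_distrib[of "\<lambda>x. x * _"] cong: if_cong)
    with True show ?thesis
      using Suc.hyps(2) by (intro exI[of _ "\<lambda>j. if j = Suc n then 1 else 0"]) auto
  next
    case False
    obtain \<beta> where \<beta>: "F (Suc n) - lincomb B \<beta> \<in> I"
      using basis_mod_coords[OF Suc.prems] .
    obtain b where b: "b \<in> B" "\<beta> b \<noteq> 0"
      using basis_mod_coord_nonzero[OF Suc.prems(1) \<beta> False] by blast
    have "n = card (B - {b})"
      using Suc.hyps(2) b fin by simp
    from Suc.hyps(1)[OF this csubspace_add_line[OF Suc.prems(1)] basis_mod_remove[OF Suc.prems \<beta> b]]
    obtain c where c: "\<exists>j\<le>n. c j \<noteq> 0"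
      "(\<Sum>j\<le>n. const_poly (c j) * F j) \<in> add_line I (F (Suc n))"
      using \<open>n = card (B - {b})\<close> by auto
    from c(2) obtain d where d: "(\<Sum>j\<le>n. const_poly (c j) * F j) - const_poly d * F (Suc n) \<in> I"
      by (auto simp: mem_add_line_iff)
    have "(\<Sum>j\<le>n. const_poly ((c(Suc n := - d)) j) * F j) = (\<Sum>j\<le>n. const_poly (c j) * F j)"
      by (rule sum.cong) auto
    with d have "(\<Sum>j\<le>card B. const_poly ((c(Suc n := - d)) j) * F j) \<in> I"
      unfolding Suc.hyps(2)[symmetric] by (simp add: const_poly_simps)
    moreover have "\<exists>j\<le>card B. (c(Suc n := - d)) j \<noteq> 0"
      using c(1) Suc.hyps(2) by (metis Suc_n_not_le_n fun_upd_other le_SucI)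
    ultimately show ?thesis by blast
  qed
qed

text \<open>The charts cover the Hilbert scheme: monomials span, so a basis element that is not a monomial
  can be exchanged for a monomial, without changing the size of the basis.\<close>

lemma monomial_basis_mod:
  fixes I :: "'v mpoly set"
  assumes "csubspace I" "basis_mod I B"
  shows "\<exists>M. finite M \<and> card M = card B \<and> basis_mod I (mon ` M)"
  using assms(2)
proof (induction "card (B - range mon)" arbitrary: B rule: less_induct)
  case less
  note fin = basis_mod_finite[OF less.prems]
  have inj: "inj (mon :: ('v \<Rightarrow>\<^sub>0 nat) \<Rightarrow> 'v mpoly)"
    unfolding mon_def by (intro injI) (metis keys_single singleton_inject zero_neq_one)
  show ?case
  proof (cases "B \<subseteq> range mon")
    case True
    then have "mon ` (mon -` B) = B" by blast
    moreover from this have "card (mon -` B) = card B"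
      using card_image[OF inj_on_subset[OF inj], of "mon -` B"] by simp
    ultimately show ?thesis
      using less.prems fin inj by (intro exI[of _ "mon -` B"]) (simp add: finite_vimageI)
  next
    case False
    then obtain b where b: "b \<in> B" "b \<notin> range mon" by blast
    \<comment> \<open>If no monomial involved b, the span of the other basis elements would be everything, b included.\<close>
    have "\<exists>m a. mon m - lincomb B a \<in> I \<and> a b \<noteq> 0"
    proof (rule ccontr)
      assume contra: "\<not> ?thesis"
      have "\<exists>a. p - lincomb B a \<in> I \<and> a b = 0" for p
      proof (induction p rule: poly_mapping_add_single_induct)
        case zero
        show ?case
          using csubspace_0[OF assms(1)] by (intro exI[of _ "\<lambda>_. 0"]) (simp add: lincomb_def)
      next
        case (add p m c)
        obtain a where a: "p - lincomb B a \<in> I" "a b = 0"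
          using add by blast
        obtain a' where a': "mon m - lincomb B a' \<in> I"
          using basis_mod_coords[OF assms(1) less.prems] .
        with contra have "a' b = 0" by blast
        have "const_poly c * (mon m - lincomb B a') + (p - lincomb B a) \<in> I"
          by (intro csubspace_add[OF assms(1) csubspace_scale[OF assms(1) a'] a(1)])
        moreover have "Poly_Mapping.single m c = const_poly c * mon m"
          by (simp add: const_poly_def mon_def mult_single)
        ultimately have "Poly_Mapping.single m c + p - lincomb B (\<lambda>b. c * a' b + a b) \<in> I"
          by (simp add: lincomb_add lincomb_scale algebra_simps)
        with a(2) \<open>a' b = 0\<close> show ?case
          by (intro exI[of _ "\<lambda>b. c * a' b + a b"]) simp
      qed
      then obtain a where a: "b - lincomb B a \<in> I" "a b = 0" by blast
      have "lincomb B (\<lambda>b'. (if b' = b then 1 else 0) - a b') \<in> I"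
        using a fin b(1) by (simp add: lincomb_diff lincomb_indicator)
      from basis_mod_independent[OF assms(1) less.prems this b(1)] a(2) show False by simp
    qed
    then obtain m a where ma: "mon m - lincomb B a \<in> I" "a b \<noteq> 0" by blast
    let ?B = "insert (mon m) (B - {b})"
    note exch = basis_mod_exchange[OF assms(1) less.prems ma(1) b(1) ma(2)]
    have "?B - range mon = (B - range mon) - {b}" by auto
    then have "card (?B - range mon) < card (B - range mon)"
      using b fin card_Diff1_less[of "B - range mon" b] by simp
    from less.hyps[OF this exch(2)] have "\<exists>M. finite M \<and> card M = card ?B \<and> basis_mod I (mon ` M)" .
    moreover have "card ?B = card B"
      using exch(1) b(1) fin by (metis card_Suc_Diff1 card_insert_disjoint finite_Diff)
    ultimately show ?thesis by simp
  qed
qed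

section \<open>Hyperplanes in ideals\<close>

definition hyperplane :: "'v mpoly set \<Rightarrow> 'v mpoly set \<Rightarrow> bool" where
  "hyperplane J I \<longleftrightarrow> (\<exists>f. f \<notin> J \<and> I = add_line J f)"

lemma hyperplane_subset: "hyperplane J I \<Longrightarrow> J \<subseteq> I"
  using add_line_superset by (auto simp: hyperplane_def)

lemma has_colength_hyperplane:
  assumes "csubspace J" "hyperplane J I" "has_colength I k"
  shows "has_colength J (Suc k)"
proof -
  obtain f where f: "f \<notin> J" "I = add_line J f"
    using assms(2) by (auto simp: hyperplane_def)
  obtain B where B: "basis_mod I B" "card B = k"
    using assms(3) by (auto simp: has_colength_def)
  have "f \<notin> B" "basis_mod J (insert f B)"
    using basis_mod_insert[OF assms(1) f(1)] B(1) f(2) by auto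
  moreover have "card (insert f B) = Suc k"
    using \<open>f \<notin> B\<close> B basis_mod_finite[OF B(1)] by simp
  ultimately show ?thesis
    unfolding has_colength_def by blast
qed

lemma has_colength_of_hyperplane:
  assumes "csubspace J" "hyperplane J I" "has_colength J (Suc k)"
  shows "has_colength I k"
proof -
  obtain f where f: "f \<notin> J" "I = add_line J f"
    using assms(2) by (auto simp: hyperplane_def)
  obtain B where B: "basis_mod J B" "card B = Suc k"
    using assms(3) by (auto simp: has_colength_def)
  obtain \<beta> where \<beta>: "f - lincomb B \<beta> \<in> J"
    using basis_mod_coords[OF assms(1) B(1)] .
  obtain b where b: "b \<in> B" "\<beta> b \<noteq> 0"
    using basis_mod_coord_nonzero[OF assms(1) \<beta> f(1)] by blast
  have "basis_mod I (B - {b})"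
    using basis_mod_remove[OF assms(1) B(1) \<beta> b] f(2) by simp
  moreover have "card (B - {b}) = k"
    using b(1) B basis_mod_finite by (simp add: card_Diff_singleton)
  ultimately show ?thesis
    unfolding has_colength_def by blast
qed

lemma add_line_subset:
  assumes "csubspace K" "L \<subseteq> K" "f \<in> K"
  shows "add_line L f \<subseteq> K"
proof
  fix g assume "g \<in> add_line L f"
  then obtain l c where "l \<in> L" "g = l + const_poly c * f"
    by (auto simp: add_line_def)
  then show "g \<in> K"
    using csubspace_add[OF assms(1) _ csubspace_scale[OF assms(1,3)], of l c] assms(2) by blast
qed

lemma hyperplane_eq_add_line:
  assumes J: "csubspace J" and hyp: "hyperplane J I" and f: "f \<in> I" "f \<notin> J"
  shows "I = add_line J f"
proof
  obtain g where g: "I = add_line J g"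
    using hyp by (auto simp: hyperplane_def)
  then obtain c where c: "f - const_poly c * g \<in> J"
    using f(1) by (auto simp: mem_add_line_iff)
  have "c \<noteq> 0"
    using c f(2) by auto
  show "I \<subseteq> add_line J f"
  proof
    fix x assume "x \<in> I"
    then obtain d where d: "x - const_poly d * g \<in> J"
      using g by (auto simp: mem_add_line_iff)
    have "(x - const_poly d * g) - const_poly (d / c) * (f - const_poly c * g) \<in> J"
      by (rule csubspace_diff[OF J d csubspace_scale[OF J c]])
    moreover have "const_poly (d / c) * (const_poly c * g) = const_poly d * g"
      using \<open>c \<noteq> 0\<close> by (simp flip: mult.assoc const_poly_mult)
    ultimately have "x - const_poly (d / c) * f \<in> J"
      by (simp add: algebra_simps)
    then show "x \<in> add_line J f"
      by (auto simp: mem_add_line_iff)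
  qed
  show "add_line J f \<subseteq> I"
    using add_line_subset[OF _ hyperplane_subset[OF hyp] f(1)] csubspace_add_line[OF J] g by blast
qed

text \<open>Two distinct hyperplanes intersect in a hyperplane of each: neither contains the other, so
  K1 + K2 = I and K1 / (K1 \<inter> K2) is isomorphic to I / K2. This produces the ideals of the next
  colength that link consecutive members of a chain.\<close>

lemma hyperplane_Int:
  assumes K1: "csubspace K1" and K2: "csubspace K2"
    and hyp1: "hyperplane K1 I" and hyp2: "hyperplane K2 I" and ne: "K1 \<noteq> K2"
  shows "hyperplane (K1 \<inter> K2) K1"
proof -
  have "\<not> K1 \<subseteq> K2"
  proof
    assume "K1 \<subseteq> K2"
    with ne obtain h where "h \<in> K2" "h \<notin> K1" by blast
    with hyp2 have "I = add_line K1 h"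
      using hyperplane_eq_add_line[OF K1 hyp1] hyperplane_subset by blast
    then have "I \<subseteq> K2"
      using add_line_subset[OF K2 \<open>K1 \<subseteq> K2\<close> \<open>h \<in> K2\<close>] by simp
    then show False
      using hyp2 add_line_self[OF K2] by (auto simp: hyperplane_def)
  qed
  then obtain h where h: "h \<in> K1" "h \<notin> K2" by blast
  then have I: "I = add_line K2 h"
    using hyperplane_eq_add_line[OF K2 hyp2] hyperplane_subset[OF hyp1] by blast
  have "K1 \<subseteq> add_line (K1 \<inter> K2) h"
  proof
    fix x assume x: "x \<in> K1"
    then have "x \<in> add_line K2 h"
      using hyperplane_subset[OF hyp1] I by blast
    then obtain c where c: "x - const_poly c * h \<in> K2"
      unfolding mem_add_line_iff ..
    have "x - const_poly c * h \<in> K1"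
      by (rule csubspace_diff[OF K1 x csubspace_scale[OF K1 h(1)]])
    with c show "x \<in> add_line (K1 \<inter> K2) h"
      by (auto simp: mem_add_line_iff)
  qed
  moreover have "add_line (K1 \<inter> K2) h \<subseteq> K1"
    by (rule add_line_subset[OF K1 _ h(1)]) blast
  ultimately show ?thesis
    using h by (auto simp: hyperplane_def)
qed

section \<open>Joint eigenvectors of the variables\<close>

definition subst_poly :: "complex poly \<Rightarrow> 'v mpoly \<Rightarrow> 'v mpoly" where
  "subst_poly p h = poly (map_poly const_poly p) h"

lemma subst_poly_add: "subst_poly (p + q) h = subst_poly p h + subst_poly q h"
proof -
  have "map_poly const_poly (p + q) = map_poly const_poly p + (map_poly const_poly q :: 'a mpoly poly)"
    by (rule poly_eqI) (simp add: coeff_map_poly const_poly_add)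
  then show ?thesis by (simp add: subst_poly_def)
qed

lemma subst_poly_0: "subst_poly 0 h = 0"
  by (simp add: subst_poly_def)

lemma subst_poly_pCons: "subst_poly (pCons a p) h = const_poly a + h * subst_poly p h"
  by (simp add: subst_poly_def map_poly_pCons)

lemma subst_poly_smult: "subst_poly (smult c p) h = const_poly c * subst_poly p h"
  by (induction p) (simp_all add: subst_poly_0 subst_poly_pCons const_poly_mult algebra_simps)

lemma subst_poly_linear_mult:
  "subst_poly ([:- c, 1:] * q) h = (h - const_poly c) * subst_poly q h"
proof -
  have "[:- c, 1:] * q = smult (- c) q + pCons 0 q" by simp
  then show ?thesis
    by (simp only: subst_poly_add subst_poly_smult subst_poly_pCons const_poly_0 const_poly_uminus)
       (simp add: algebra_simps)
qed

lemma subst_poly_sum_monom: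
  "subst_poly (\<Sum>j\<in>S. monom (c j) j) h = (\<Sum>j\<in>S. const_poly (c j) * h ^ j)"
  by (induction S rule: infinite_finite_induct)
     (simp_all add: subst_poly_0 subst_poly_add,
      simp add: subst_poly_def map_poly_monom poly_monom)

text \<open>A polynomial in h that kills a nonzero vector w of K/I splits into linear factors. Applying them to
  w one after the other, some factor h - c kills a vector that is still nonzero.\<close>

lemma eigenvector_of_annihilator:
  assumes I: "is_ideal I" and K: "is_ideal K"
  shows "p \<noteq> 0 \<Longrightarrow> w \<in> K \<Longrightarrow> w \<notin> I \<Longrightarrow> subst_poly p h * w \<in> I \<Longrightarrow>
    \<exists>c. \<exists>w'\<in>K. w' \<notin> I \<and> (h - const_poly c) * w' \<in> I"
proof (induction "degree p" arbitrary: p)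
  case 0
  then obtain a where "p = [:a:]"
    by (metis degree_eq_zeroE)
  with 0 have "w \<in> I"
    using csubspace_scale_cancel[OF is_ideal_csubspace[OF I], of a w]
    by (simp add: subst_poly_pCons subst_poly_0)
  with 0 show ?case by simp
next
  case (Suc d)
  then have "\<not> constant (poly p)"
    by (simp add: constant_degree)
  then obtain c where "poly p c = 0"
    using fundamental_theorem_of_algebra by blast
  then obtain q where q: "p = [:- c, 1:] * q"
    by (auto simp: poly_eq_0_iff_dvd)
  with Suc.prems have "q \<noteq> 0" by auto
  with q have "degree q = d"
    using Suc.hyps(2) by (simp add: degree_mult_eq del: mult_pCons_left)
  show ?case
  proof (cases "subst_poly q h * w \<in> I")
    case True
    then show ?thesis
      using Suc.hyps(1)[of q] \<open>degree q = d\<close> \<open>q \<noteq> 0\<close> Suc.prems by blast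
  next
    case False
    moreover have "(h - const_poly c) * (subst_poly q h * w) \<in> I"
      using Suc.prems(4) unfolding q subst_poly_linear_mult by (simp only: mult.assoc)
    ultimately show ?thesis
      using is_ideal_mult[OF K Suc.prems(2)] by blast
  qed
qed

text \<open>The powers of h applied to u are dependent modulo I, which gives an annihilating polynomial.\<close>

lemma exists_eigenvector:
  assumes I: "is_ideal I" "has_colength I k" and K: "is_ideal K" and u: "u \<in> K" "u \<notin> I"
  shows "\<exists>c. \<exists>w\<in>K. w \<notin> I \<and> (h - const_poly c) * w \<in> I"
proof -
  obtain B where B: "basis_mod I B"
    using I(2) by (auto simp: has_colength_def)
  obtain c where c: "\<exists>j\<le>card B. c j \<noteq> 0" "(\<Sum>j\<le>card B. const_poly (c j) * (h ^ j * u)) \<in> I"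
    using dependent_mod[OF is_ideal_csubspace[OF I(1)] B, of "\<lambda>j. h ^ j * u"] by blast
  let ?p = "\<Sum>j\<le>card B. monom (c j) j"
  obtain j where j: "j \<le> card B" "c j \<noteq> 0"
    using c(1) by blast
  have "coeff ?p j = c j"
    using j(1) by (simp add: coeff_sum)
  with j(2) have "?p \<noteq> 0" by auto
  moreover have "subst_poly ?p h * u \<in> I"
    using c(2) by (simp add: subst_poly_sum_monom sum_distrib_right mult.assoc)
  ultimately show ?thesis
    using eigenvector_of_annihilator[OF I(1) K] u by blast
qed

text \<open>Since the variables commute, the vectors of K/I on which one of them acts as a given eigenvalue
  again form an ideal modulo I, and the next variable can be treated inside it.\<close>

lemma exists_joint_eigenspace:
  assumes I: "is_ideal I" "has_colength I k" and K: "is_ideal K" "I \<subset> K" and "finite S"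
  shows "\<exists>K'. is_ideal K' \<and> I \<subset> K' \<and> K' \<subseteq> K \<and>
    (\<forall>v\<in>S. \<exists>c. \<forall>u\<in>K'. (var v - const_poly c) * u \<in> I)"
  using \<open>finite S\<close>
proof induction
  case empty
  then show ?case using K by blast
next
  case (insert v S)
  then obtain K' where K': "is_ideal K'" "I \<subset> K'" "K' \<subseteq> K"
    "\<forall>v\<in>S. \<exists>c. \<forall>u\<in>K'. (var v - const_poly c) * u \<in> I"
    by blast
  then obtain u where "u \<in> K'" "u \<notin> I" by blast
  then obtain c w where w: "w \<in> K'" "w \<notin> I" "(var v - const_poly c) * w \<in> I"
    using exists_eigenvector[OF I K'(1), of u "var v"] by blast
  define K'' where "K'' = {u \<in> K'. (var v - const_poly c) * u \<in> I}"
  have "is_ideal K''"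
    using K'(1) I(1) by (auto simp: is_ideal_iff K''_def distrib_left mult.left_commute)
  moreover have "I \<subset> K''"
    using K'(2) I(1) w by (auto simp: K''_def is_ideal_mult)
  moreover have "\<forall>v\<in>insert v S. \<exists>c. \<forall>u\<in>K''. (var v - const_poly c) * u \<in> I"
    using K'(4) unfolding K''_def by blast
  ultimately show ?case
    using K'(3) by (intro exI[of _ K'']) (auto simp: K''_def)
qed

section \<open>Ideals supported at the origin\<close>

text \<open>On a joint eigenvector of the variables every polynomial acts as a scalar, namely as its value at the
  point of eigenvalues.\<close>

lemma acts_by_evaluation:
  assumes I: "is_ideal I" and eigen: "\<And>v. (var v - const_poly (a v)) * f \<in> I"
  shows "(h - const_poly (eval_poly a h)) * f \<in> I"
proof (induction h rule: mpoly_induct)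
  case (const c)
  then show ?case
    using I by (simp add: is_ideal_iff)
next
  case (var v)
  then show ?case
    using eigen by simp
next
  case (add g h)
  have "(g + h - const_poly (eval_poly a (g + h))) * f =
    (g - const_poly (eval_poly a g)) * f + (h - const_poly (eval_poly a h)) * f"
    by (simp add: const_poly_simps algebra_simps)
  with add show ?case
    using I by (simp add: is_ideal_iff)
next
  case (mult g h)
  have "(g * h - const_poly (eval_poly a (g * h))) * f =
    g * ((h - const_poly (eval_poly a h)) * f) +
    const_poly (eval_poly a h) * ((g - const_poly (eval_poly a g)) * f)"
    by (simp add: const_poly_simps algebra_simps)
  moreover have "g * ((h - const_poly (eval_poly a h)) * f) \<in> I"
    "const_poly (eval_poly a h) * ((g - const_poly (eval_poly a g)) * f) \<in> I"
    using mult I by (simp_all only: is_ideal_iff)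
  ultimately show ?case
    using I by (simp only: is_ideal_iff)
qed

text \<open>For h in I the product h f lies in I, while h acts on f as the scalar h(a); as f is nonzero modulo I,
  h(a) = 0.\<close>

lemma eigenvalue_in_zero_locus:
  assumes I: "is_ideal I" and eigen: "\<And>v. (var v - const_poly (a v)) * f \<in> I" and f: "f \<notin> I"
  shows "a \<in> zero_locus I"
proof -
  have "eval_poly a h = 0" if h: "h \<in> I" for h
  proof (rule ccontr)
    assume "eval_poly a h \<noteq> 0"
    have "f * h \<in> I"
      by (rule is_ideal_mult[OF I h])
    from csubspace_diff[OF is_ideal_csubspace[OF I] this acts_by_evaluation[OF I eigen, of h]]
    have "const_poly (eval_poly a h) * f \<in> I"
      by (simp add: algebra_simps)
    then show False
      using csubspace_scale_cancel[OF is_ideal_csubspace[OF I] _ \<open>eval_poly a h \<noteq> 0\<close>] f by blast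
  qed
  then show ?thesis
    by (simp add: zero_locus_def)
qed

text \<open>On the line I/J the variables act as scalars. Their eigenvalues form a common zero of J, which can only
  be the origin.\<close>

lemma hyperplane_at_origin:
  assumes J: "is_ideal J" and I: "is_ideal I" and hyp: "hyperplane J I"
    and zl: "zero_locus J = {\<lambda>_. 0}" and f: "f \<in> I"
  shows "(h - const_poly (eval_poly (\<lambda>_. 0) h)) * f \<in> J"
proof (cases "f \<in> J")
  case True
  then show ?thesis
    by (rule is_ideal_mult[OF J])
next
  case False
  note J' = is_ideal_csubspace[OF J]
  have "I = add_line J f"
    by (rule hyperplane_eq_add_line[OF J' hyp f False])
  then have "\<exists>c. var v * f - const_poly c * f \<in> J" for v
    using is_ideal_mult[OF I f, of "var v"] by (simp add: mem_add_line_iff)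
  then obtain a where "\<And>v. var v * f - const_poly (a v) * f \<in> J"
    by metis
  then have a: "\<And>v. (var v - const_poly (a v)) * f \<in> J"
    by (simp add: algebra_simps)
  have "a = (\<lambda>_. 0)"
    using eigenvalue_in_zero_locus[OF J a False] zl by simp
  then show ?thesis
    using acts_by_evaluation[OF J a, of h] by simp
qed

lemma is_ideal_add_line:
  assumes L: "is_ideal L" and f: "\<And>h. (h - const_poly (eval_poly a h)) * f \<in> L"
  shows "is_ideal (add_line L f)"
proof -
  note L' = is_ideal_csubspace[OF L]
  have "h * x \<in> add_line L f" if "x \<in> add_line L f" for h x
  proof -
    obtain c where c: "x - const_poly c * f \<in> L"
      using \<open>x \<in> add_line L f\<close> by (auto simp: mem_add_line_iff)
    have "h * (x - const_poly c * f) + const_poly c * ((h - const_poly (eval_poly a h)) * f) \<in> L"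
      by (rule csubspace_add[OF L' is_ideal_mult[OF L c] csubspace_scale[OF L' f]])
    then have "h * x - const_poly (c * eval_poly a h) * f \<in> L"
      by (simp add: const_poly_simps algebra_simps)
    then show ?thesis
      by (auto simp: mem_add_line_iff)
  qed
  then show ?thesis
    using csubspace_add_line[OF L', of f] by (simp add: is_ideal_iff csubspace_def)
qed

lemma punctual_hilb_iff:
  "I \<in> punctual_hilb k \<longleftrightarrow> is_ideal I \<and> has_colength I k \<and> zero_locus I = {\<lambda>_. 0}"
  by (simp add: punctual_hilb_def hilb_def)

abbreviation origin_ideal :: "'v mpoly set" where
  "origin_ideal \<equiv> {f. eval_poly (\<lambda>_. 0) f = 0}"

lemma is_ideal_origin_ideal: "is_ideal origin_ideal"
  by (simp add: is_ideal_iff)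

lemma punctual_hilb_subset_origin: "I \<in> punctual_hilb k \<Longrightarrow> I \<subseteq> origin_ideal"
  by (auto simp: punctual_hilb_iff zero_locus_def)

lemma zero_locus_antimono: "I \<subseteq> J \<Longrightarrow> zero_locus J \<subseteq> zero_locus I"
  by (auto simp: zero_locus_def)

lemma punctual_hilb_1:
  assumes I: "I \<in> punctual_hilb 1"
  shows "I = origin_ideal"
proof
  show "I \<subseteq> origin_ideal"
    by (rule punctual_hilb_subset_origin[OF I])
next
  have I': "csubspace I" and "has_colength I 1"
    using I is_ideal_csubspace by (auto simp: punctual_hilb_iff)
  then obtain b where basis: "basis_mod I {b}"
    unfolding has_colength_def by (metis card_1_singletonE)
  have coords: "\<exists>c. f - const_poly c * b \<in> I" for f
    using basis_mod_coords[OF I' basis, of f] by (auto simp: lincomb_def)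
  obtain c where "1 - const_poly c * b \<in> I"
    using coords by blast
  then have "eval_poly (\<lambda>_. 0) (1 - const_poly c * b) = 0"
    using punctual_hilb_subset_origin[OF I] by blast
  then have b: "eval_poly (\<lambda>_. 0) b \<noteq> 0" by auto
  show "origin_ideal \<subseteq> I"
  proof
    fix f :: "'a mpoly" assume f: "f \<in> origin_ideal"
    obtain c where c: "f - const_poly c * b \<in> I"
      using coords by blast
    then have "eval_poly (\<lambda>_. 0) (f - const_poly c * b) = 0"
      using punctual_hilb_subset_origin[OF I] by blast
    with f b have "c = 0" by simp
    with c show "f \<in> I" by simp
  qed
qed

text \<open>Polynomials vanishing at 0 have codimension one only: for two basis elements b, b' the combination
  b'(0) b - b(0) b' vanishes at 0, and would be a relation modulo I.\<close>

lemma origin_ideal_not_subset: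
  assumes I: "csubspace I" "has_colength I (Suc (Suc k))"
  shows "\<not> origin_ideal \<subseteq> I"
proof
  assume sub: "origin_ideal \<subseteq> I"
  obtain B where B: "basis_mod I B" "card B = Suc (Suc k)"
    using I(2) by (auto simp: has_colength_def)
  note fin = basis_mod_finite[OF B(1)]
  obtain b where b: "b \<in> B"
    using B(2) by fastforce
  have "card (B - {b}) = Suc k"
    using b B(2) fin by simp
  then obtain b' where b': "b' \<in> B" "b' \<noteq> b"
    by (metis card_eq_SucD insertCI Diff_iff singletonI)
  let ?e = "eval_poly (\<lambda>_. 0)"
  let ?\<delta> = "\<lambda>b b'. if b' = b then 1 else (0 :: complex)"
  have "const_poly (?e b') * b - const_poly (?e b) * b' \<in> I"
    using sub by auto
  then have "lincomb B (\<lambda>x. ?e b' * ?\<delta> b x - ?e b * ?\<delta> b' x) \<in> I"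
    using fin b b'(1) by (simp only: lincomb_diff lincomb_scale lincomb_indicator)
  from basis_mod_independent[OF I(1) B(1) this b] b' have "?e b' = 0" by simp
  then have "b' \<in> I"
    using sub by auto
  then have "lincomb B (?\<delta> b') \<in> I"
    using fin b'(1) by (simp only: lincomb_indicator)
  from basis_mod_independent[OF I(1) B(1) this b'(1)] show False by simp
qed

text \<open>The joint eigenvector is sought in m/I and not in the whole quotient, so that the larger ideal stays
  inside m and does not lose the zero at the origin. For colength at least two m/I is not zero.\<close>

lemma exists_punctual_containing:
  assumes I: "I \<in> punctual_hilb (Suc (Suc k))"
  shows "\<exists>I'\<in>punctual_hilb (Suc k). hyperplane I I'"
proof -
  have ideal: "is_ideal I" and len: "has_colength I (Suc (Suc k))" and zl: "zero_locus I = {\<lambda>_. 0}"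
    using I by (auto simp: punctual_hilb_iff)
  note I' = is_ideal_csubspace[OF ideal]
  have "I \<subset> origin_ideal"
    using punctual_hilb_subset_origin[OF I] origin_ideal_not_subset[OF I' len] by blast
  then obtain K where K: "is_ideal K" "I \<subset> K" "K \<subseteq> origin_ideal"
    "\<forall>v. \<exists>c. \<forall>u\<in>K. (var v - const_poly c) * u \<in> I"
    using exists_joint_eigenspace[OF ideal len is_ideal_origin_ideal, of UNIV] by auto
  then obtain f where f: "f \<in> K" "f \<notin> I" by blast
  obtain a where a: "\<And>v. (var v - const_poly (a v)) * f \<in> I"
    using K(4) f(1) by metis
  let ?I' = "add_line I f"
  have hyp: "hyperplane I ?I'"
    using f(2) by (auto simp: hyperplane_def)
  have "is_ideal ?I'"
    using is_ideal_add_line[OF ideal acts_by_evaluation[OF ideal a]] .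
  moreover have "has_colength ?I' (Suc k)"
    by (rule has_colength_of_hyperplane[OF I' hyp len])
  moreover have "zero_locus ?I' = {\<lambda>_. 0}"
  proof -
    have "?I' \<subseteq> origin_ideal"
      using add_line_subset[OF is_ideal_csubspace[OF K(1)] _ f(1), of I] K(2,3) by blast
    then have "(\<lambda>_. 0) \<in> zero_locus ?I'"
      by (auto simp: zero_locus_def)
    then show ?thesis
      using zero_locus_antimono[OF add_line_superset[of I f]] zl by blast
  qed
  ultimately show ?thesis
    using hyp by (auto simp: punctual_hilb_iff)
qed

text \<open>No zero away from the origin is gained by intersecting, because the product of an element of K1 and
  one of K2 lies in both.\<close>

lemma punctual_hilb_Int:
  assumes K1: "K1 \<in> punctual_hilb k" and K2: "K2 \<in> punctual_hilb k"
    and hyp: "hyperplane (K1 \<inter> K2) K1"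
  shows "K1 \<inter> K2 \<in> punctual_hilb (Suc k)"
proof -
  have ideal: "is_ideal (K1 \<inter> K2)"
    using K1 K2 by (simp add: punctual_hilb_iff is_ideal_iff)
  moreover have "has_colength (K1 \<inter> K2) (Suc k)"
    using has_colength_hyperplane[OF is_ideal_csubspace[OF ideal] hyp] K1
    by (simp add: punctual_hilb_iff)
  moreover have "zero_locus (K1 \<inter> K2) = {\<lambda>_. 0}"
  proof
    show "{\<lambda>_. 0} \<subseteq> zero_locus (K1 \<inter> K2)"
      using zero_locus_antimono[of "K1 \<inter> K2" K1] K1 by (auto simp: punctual_hilb_iff)
    show "zero_locus (K1 \<inter> K2) \<subseteq> {\<lambda>_. 0}"
    proof
      fix a assume a: "a \<in> zero_locus (K1 \<inter> K2)"
      show "a \<in> {\<lambda>_. 0}"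
      proof (rule ccontr)
        assume "a \<notin> {\<lambda>_. 0}"
        then have "a \<notin> zero_locus K1" "a \<notin> zero_locus K2"
          using K1 K2 by (simp_all add: punctual_hilb_iff)
        then obtain f g where fg: "f \<in> K1" "eval_poly a f \<noteq> 0" "g \<in> K2" "eval_poly a g \<noteq> 0"
          by (auto simp: zero_locus_def)
        have "g * f \<in> K1" "f * g \<in> K2"
          using K1 K2 fg by (auto simp: punctual_hilb_iff intro: is_ideal_mult)
        then have "f * g \<in> K1 \<inter> K2"
          by (simp add: mult.commute)
        then have "eval_poly a (f * g) = 0"
          using a unfolding zero_locus_def by blast
        with fg show False by simp
      qed
    qed
  qed
  ultimately show ?thesis
    by (simp add: punctual_hilb_iff)
qed

section \<open>Chains of adjacent ideals\<close>

definition adjacent :: "nat \<Rightarrow> ('n::finite mpoly set \<times> 'n mpoly set) set" where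
  "adjacent k = {(I, J). I \<in> punctual_hilb k \<and> J \<in> punctual_hilb k \<and>
                         (\<exists>K. hyperplane I K \<and> hyperplane J K)}"

text \<open>In the inner induction the statement is proved for every ideal J below the current end K of the
  chain of larger ideals. Extending the chain to K', an ideal J below K' is adjacent to K \<inter> K', which is
  below K.\<close>

lemma adjacent_chain:
  assumes "I \<in> punctual_hilb (Suc k)" "J \<in> punctual_hilb (Suc k)"
  shows "(I, J) \<in> (adjacent (Suc k))\<^sup>*"
  using assms
proof (induction k arbitrary: I J)
  case 0
  then have "I = J"
    using punctual_hilb_1 by (metis One_nat_def)
  then show ?case by simp
next
  case (Suc k)
  obtain I' where I': "I' \<in> punctual_hilb (Suc k)" "hyperplane I I'"
    using exists_punctual_containing[OF Suc.prems(1)] by blast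
  obtain J' where J': "J' \<in> punctual_hilb (Suc k)" "hyperplane J J'"
    using exists_punctual_containing[OF Suc.prems(2)] by blast
  have "(I', J') \<in> (adjacent (Suc k))\<^sup>*"
    by (rule Suc.IH[OF I'(1) J'(1)])
  then show ?case
    using Suc.prems(2) J'(2)
  proof (induction arbitrary: J rule: rtrancl_induct)
    case base
    then show ?case
      using Suc.prems(1) I'(2) by (auto simp: adjacent_def)
  next
    case (step K K')
    show ?case
    proof (cases "K = K'")
      case True
      then show ?thesis
        using step.IH step.prems by blast
    next
      case False
      obtain M where K: "K \<in> punctual_hilb (Suc k)" "hyperplane K M"
        and K': "K' \<in> punctual_hilb (Suc k)" "hyperplane K' M"
        using step.hyps(2) by (auto simp: adjacent_def)
      have sub: "csubspace K" "csubspace K'"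
        using K(1) K'(1) is_ideal_csubspace by (auto simp: punctual_hilb_iff)
      have L: "hyperplane (K \<inter> K') K" "hyperplane (K \<inter> K') K'"
        using hyperplane_Int[OF sub K(2) K'(2) False]
          hyperplane_Int[OF sub(2,1) K'(2) K(2) False[symmetric]]
        by (simp_all add: Int_commute)
      have "K \<inter> K' \<in> punctual_hilb (Suc (Suc k))"
        by (rule punctual_hilb_Int[OF K(1) K'(1) L(1)])
      then have "(I, K \<inter> K') \<in> (adjacent (Suc (Suc k)))\<^sup>*" "(K \<inter> K', J) \<in> adjacent (Suc (Suc k))"
        using step.IH[OF _ L(1)] step.prems L(2) by (auto simp: adjacent_def)
      then show ?thesis by (rule rtrancl_into_rtrancl)
    qed
  qed
qed

section \<open>Pencils of ideals\<close>

text \<open>Coordinates modulo a neighbouring line: if f' = c f + (a combination of B) modulo L with c \<noteq> 0, then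
  modulo L + C f' the vector f can be eliminated in favour of B. The second part is the resulting
  change of coordinates.\<close>

lemma add_line_change:
  assumes L: "csubspace L" and f: "f \<notin> L" and basis: "basis_mod (add_line L f) B"
    and f': "f' - const_poly c * f - lincomb B \<beta> \<in> L" and c: "c \<noteq> 0"
  shows "basis_mod (add_line L f') B"
    and "p - const_poly \<mu> * f - lincomb B a \<in> L \<Longrightarrow>
      p - lincomb B (\<lambda>b. a b - \<mu> / c * \<beta> b) \<in> add_line L f'"
proof -
  note fin = basis_mod_finite[OF basis]
  note ins = basis_mod_insert[OF L f basis]
  have "lincomb B (\<beta>(f := c)) = lincomb B \<beta>"
    by (rule lincomb_cong) (use ins(1) in auto)
  then have "f' - lincomb (insert f B) (\<beta>(f := c)) \<in> L"
    using f' fin ins(1) by (simp add: lincomb_insert algebra_simps)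
  from basis_mod_remove[OF L ins(2) this, of f] c ins(1)
  show "basis_mod (add_line L f') B" by simp
next
  assume p: "p - const_poly \<mu> * f - lincomb B a \<in> L"
  have "const_poly (\<mu> / c) * (const_poly c * f) = const_poly \<mu> * f"
    using c by (simp flip: mult.assoc const_poly_mult)
  moreover have "(p - const_poly \<mu> * f - lincomb B a) -
      const_poly (\<mu> / c) * (f' - const_poly c * f - lincomb B \<beta>) \<in> L"
    by (rule csubspace_diff[OF L p csubspace_scale[OF L f']])
  ultimately have "p - lincomb B (\<lambda>b. a b - \<mu> / c * \<beta> b) - const_poly (\<mu> / c) * f' \<in> L"
    by (simp only: lincomb_diff lincomb_scale) (simp add: algebra_simps)
  then show "p - lincomb B (\<lambda>b. a b - \<mu> / c * \<beta> b) \<in> add_line L f'"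
    by (auto simp: mem_add_line_iff)
qed

lemma chart_coord_eq:
  assumes I: "csubspace I" and basis: "basis_mod I (mon ` B)"
    and m: "mon m - lincomb (mon ` B) a \<in> I"
  shows "chart_coord B I (m, b) = (if mon b \<in> mon ` B then a (mon b) else 0)"
proof -
  let ?a = "\<lambda>p. if p \<in> mon ` B then a p else 0"
  have "lincomb (mon ` B) ?a = lincomb (mon ` B) a"
    by (rule lincomb_cong) simp
  with m have "mon m - (\<Sum>p\<in>mon ` B. const_poly (?a p) * p) \<in> I"
    by (simp only: lincomb_def)
  moreover have "\<exists>!a. (\<forall>p. p \<notin> mon ` B \<longrightarrow> a p = 0) \<and>
      mon m - (\<Sum>p\<in>mon ` B. const_poly (a p) * p) \<in> I"
    using basis unfolding basis_mod_def by blast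
  ultimately have "(THE a. (\<forall>p. p \<notin> mon ` B \<longrightarrow> a p = 0) \<and>
      mon m - (\<Sum>p\<in>mon ` B. const_poly (a p) * p) \<in> I) = ?a"
    by (intro the1_equality) auto
  then show ?thesis
    by (simp only: chart_coord_def prod.case)
qed

text \<open>The coordinates of the member with parameter s are affine functions of u = s / (1 + \<nu> s), where \<nu> is
  the coefficient of f in the expansion of h. Hence a polynomial in the coordinates is a polynomial q
  in u, with q(0) \<noteq> 0 since the member with s = 0 lies in the open set. It has finitely many roots,
  and s is determined by u.\<close>

lemma pencil_meets_basic_open:
  fixes L :: "'n::finite mpoly set"
  defines "D \<equiv> \<lambda>k B P. {I \<in> chart k B. eval_poly (chart_coord B I) P \<noteq> 0}"
  assumes L: "csubspace L" and f: "f \<notin> L"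
    and hilb: "\<And>s. add_line L (f + const_poly s * h) \<in> hilb k"
    and mem: "add_line L f \<in> D k B P"
  shows "finite {s. add_line L (f + const_poly s * h) \<notin> D k B P}"
proof -
  let ?M = "mon ` B :: 'n mpoly set"
  have basis: "basis_mod (add_line L f) ?M" and P: "eval_poly (chart_coord B (add_line L f)) P \<noteq> 0"
    using mem by (auto simp: D_def chart_def)
  have expand: "\<exists>\<mu> a. p - const_poly \<mu> * f - lincomb ?M a \<in> L" for p
  proof -
    obtain a where "p - lincomb ?M a \<in> add_line L f"
      using basis_mod_coords[OF csubspace_add_line[OF L] basis] .
    then obtain \<mu> where "p - lincomb ?M a - const_poly \<mu> * f \<in> L"
      by (auto simp: mem_add_line_iff)
    then have "p - const_poly \<mu> * f - lincomb ?M a \<in> L"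
      by (simp add: algebra_simps)
    then show ?thesis by blast
  qed
  obtain \<nu> \<beta> where h: "h - const_poly \<nu> * f - lincomb ?M \<beta> \<in> L"
    using expand by blast
  have "\<exists>\<mu>. \<forall>m. \<exists>a. mon m - const_poly (\<mu> m) * f - lincomb ?M a \<in> L"
    by (intro choice allI expand)
  then obtain \<mu> where "\<forall>m. \<exists>a. mon m - const_poly (\<mu> m) * f - lincomb ?M a \<in> L" ..
  then obtain a where m: "\<And>m. mon m - const_poly (\<mu> m) * f - lincomb ?M (a m) \<in> L"
    using choice[of "\<lambda>m a. mon m - const_poly (\<mu> m) * f - lincomb ?M a \<in> L"] by blast
  define A where "A = (\<lambda>(m, b). if mon b \<in> ?M then [:a m (mon b), - (\<mu> m * \<beta> (mon b)):] else 0)"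
  obtain q where q: "\<And>u. eval_poly (\<lambda>v. poly (A v) u) P = poly q u"
    using eval_poly_along_curve[of A P] by blast
  have pencil: "basis_mod (add_line L (f + const_poly s * h)) ?M \<and>
      eval_poly (chart_coord B (add_line L (f + const_poly s * h))) P = poly q (s / (1 + \<nu> * s))"
    if s: "1 + \<nu> * s \<noteq> 0" for s
  proof -
    let ?f = "f + const_poly s * h"
    have "const_poly s * (h - const_poly \<nu> * f - lincomb ?M \<beta>) \<in> L"
      by (rule csubspace_scale[OF L h])
    then have f': "?f - const_poly (1 + \<nu> * s) * f - lincomb ?M (\<lambda>b. s * \<beta> b) \<in> L"
      by (simp add: lincomb_scale const_poly_simps algebra_simps)
    note change = add_line_change[OF L f basis f' s]
    have "chart_coord B (add_line L ?f) (m', b) = poly (A (m', b)) (s / (1 + \<nu> * s))" for m' b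
      using chart_coord_eq[OF csubspace_add_line[OF L] change(1) change(2)[OF m], of m' b]
      by (simp add: A_def field_simps)
    then have "chart_coord B (add_line L ?f) = (\<lambda>v. poly (A v) (s / (1 + \<nu> * s)))"
      by auto
    then show ?thesis
      using change(1) q by simp
  qed
  have "poly q 0 \<noteq> 0"
    using pencil[of 0] P by simp
  then have "q \<noteq> 0" by auto
  let ?R = "{u. poly q u = 0}"
  \<comment> \<open>u / (1 - \<nu> u) inverts s \<mapsto> s / (1 + \<nu> s).\<close>
  have "{s. add_line L (f + const_poly s * h) \<notin> D k B P} \<subseteq>
      {s. 1 + \<nu> * s = 0} \<union> (\<lambda>u. u / (1 - \<nu> * u)) ` ?R"
  proof
    fix s assume "s \<in> {s. add_line L (f + const_poly s * h) \<notin> D k B P}"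
    then have notin: "add_line L (f + const_poly s * h) \<notin> D k B P" by simp
    show "s \<in> {s. 1 + \<nu> * s = 0} \<union> (\<lambda>u. u / (1 - \<nu> * u)) ` ?R"
    proof (cases "1 + \<nu> * s = 0")
      case False
      let ?u = "s / (1 + \<nu> * s)"
      have "poly q ?u = 0"
        using notin pencil[OF False] hilb by (auto simp: D_def chart_def)
      moreover have "1 - \<nu> * ?u = 1 / (1 + \<nu> * s)"
        using False by (simp add: field_simps)
      then have "s = ?u / (1 - \<nu> * ?u)"
        using False by simp
      ultimately show ?thesis by blast
    qed simp
  qed
  moreover have "finite {s. 1 + \<nu> * s = 0}"
  proof -
    have "{s. 1 + \<nu> * s = 0} = {s. poly [:1, \<nu>:] s = 0}"
      by (simp add: mult.commute)
    also have "finite \<dots>"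
      by (rule poly_roots_finite) simp
    finally show ?thesis .
  qed
  ultimately show ?thesis
    using poly_roots_finite[OF \<open>q \<noteq> 0\<close>] by (meson finite_UnI finite_imageI finite_subset)
qed

text \<open>Continuity with respect to the cofinite topology on the parameter line. A basic open set that contains
  some member of the pencil reduces to the previous lemma by moving the base point to that member.\<close>

lemma pencil_continuous:
  fixes L :: "'n::finite mpoly set"
  defines "\<gamma> \<equiv> \<lambda>f h t. add_line L (f + const_poly t * h)"
  assumes L: "csubspace L" and f: "\<And>t. f + const_poly t * h \<notin> L"
    and hilb: "\<And>t. \<gamma> f h t \<in> hilb k" and U: "openin (hilb_zariski k) U"
  shows "(\<forall>t. \<gamma> f h t \<notin> U) \<or> finite {t. \<gamma> f h t \<notin> U}"
proof -
  have "generate_topology_on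
     {{I \<in> chart k B. eval_poly (chart_coord B I) P \<noteq> 0} | B P. finite B \<and> card B = k} U"
    using U unfolding hilb_zariski_def by (rule openin_topology_generated_by)
  then show ?thesis
  proof induction
    case Empty
    then show ?case by simp
  next
    case (Int U V)
    have "{t. \<gamma> f h t \<notin> U \<inter> V} = {t. \<gamma> f h t \<notin> U} \<union> {t. \<gamma> f h t \<notin> V}" by auto
    with Int show ?case by auto
  next
    case (UN \<U>)
    show ?case
    proof (cases "\<forall>t. \<gamma> f h t \<notin> \<Union>\<U>")
      case False
      then obtain U t where "U \<in> \<U>" "\<gamma> f h t \<in> U" by blast
      with UN have "finite {t. \<gamma> f h t \<notin> U}" by blast
      then have "finite {t. \<gamma> f h t \<notin> \<Union>\<U>}"
        by (rule rev_finite_subset) (use \<open>U \<in> \<U>\<close> in blast)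
      then show ?thesis ..
    qed simp
  next
    case (Basis D)
    then obtain B P where D: "D = {I \<in> chart k B. eval_poly (chart_coord B I) P \<noteq> 0}" by blast
    show ?case
    proof (cases "\<forall>t. \<gamma> f h t \<notin> D")
      case False
      then obtain t where t: "\<gamma> f h t \<in> D" by blast
      have shift: "\<gamma> (f + const_poly t * h) h s = \<gamma> f h (t + s)" for s
        by (simp add: \<gamma>_def const_poly_simps algebra_simps)
      have "finite {s. \<gamma> (f + const_poly t * h) h s \<notin> D}"
        unfolding \<gamma>_def D
      proof (rule pencil_meets_basic_open[OF L f])
        show "add_line L (f + const_poly t * h + const_poly s * h) \<in> hilb k" for s
          using hilb[of "t + s"] shift[of s] by (simp add: \<gamma>_def)
        show "add_line L (f + const_poly t * h)
            \<in> {I \<in> chart k B. eval_poly (chart_coord B I) P \<noteq> 0}"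
          using t by (simp add: \<gamma>_def D)
      qed
      then have "finite ((+) t ` {s. \<gamma> f h (t + s) \<notin> D})"
        unfolding shift by (rule finite_imageI)
      moreover have "{t. \<gamma> f h t \<notin> D} \<subseteq> (+) t ` {s. \<gamma> f h (t + s) \<notin> D}"
      proof
        fix r assume "r \<in> {t. \<gamma> f h t \<notin> D}"
        then show "r \<in> (+) t ` {s. \<gamma> f h (t + s) \<notin> D}"
          by (intro image_eqI[of _ _ "r - t"]) auto
      qed
      ultimately have "finite {t. \<gamma> f h t \<notin> D}"
        by (rule rev_finite_subset)
      then show ?thesis ..
    qed simp
  qed
qed

text \<open>With I = L + C f and J = L + C g, taking h = g - f puts both ideals at finite parameters, 0 and 1,
  of one affine line. No member degenerates, since f and g are independent modulo L = I \<inter> J.\<close>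

lemma adjacent_pencil:
  assumes adj: "(I, J) \<in> adjacent k" and ne: "I \<noteq> J"
  obtains L f h where "csubspace L" "\<And>t. f + const_poly t * h \<notin> L"
    "\<And>t. add_line L (f + const_poly t * h) \<in> punctual_hilb k"
    "add_line L (f + const_poly 0 * h) = I" "add_line L (f + const_poly 1 * h) = J"
proof -
  obtain K where I: "I \<in> punctual_hilb k" "hyperplane I K"
    and J: "J \<in> punctual_hilb k" "hyperplane J K"
    using adj by (auto simp: adjacent_def)
  have idI: "is_ideal I" and idJ: "is_ideal J"
    using I J by (simp_all add: punctual_hilb_iff)
  note I' = is_ideal_csubspace[OF idI] and J' = is_ideal_csubspace[OF idJ]
  define L where "L = I \<inter> J"
  have hypI: "hyperplane L I" and hypJ: "hyperplane L J"
    unfolding L_def using hyperplane_Int[OF I' J' I(2) J(2) ne]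
      hyperplane_Int[OF J' I' J(2) I(2) ne[symmetric]]
    by (simp_all add: Int_commute)
  have L: "L \<in> punctual_hilb (Suc k)"
    using punctual_hilb_Int[OF I(1) J(1)] hypI by (simp add: L_def)
  then have idL: "is_ideal L" and zlL: "zero_locus L = {\<lambda>_. 0}"
    by (simp_all add: punctual_hilb_iff)
  note L' = is_ideal_csubspace[OF idL]
  obtain f where f: "f \<notin> L" "I = add_line L f"
    using hypI by (auto simp: hyperplane_def)
  obtain g where g: "g \<notin> L" "J = add_line L g"
    using hypJ by (auto simp: hyperplane_def)
  have fI: "f \<in> I" and gJ: "g \<in> J"
    using f(2) g(2) add_line_self[OF L'] by simp_all
  have fg: "f + const_poly t * (g - f) = const_poly (1 - t) * f + const_poly t * g" for t
    by (simp add: const_poly_simps algebra_simps)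
  have notin: "f + const_poly t * (g - f) \<notin> L" for t
  proof
    assume mem: "f + const_poly t * (g - f) \<in> L"
    then have "f + const_poly t * (g - f) - const_poly (1 - t) * f \<in> I"
      using csubspace_diff[OF I' _ csubspace_scale[OF I' fI]] by (simp add: L_def)
    then have "const_poly t * g \<in> I"
      by (simp add: fg)
    moreover have "g \<notin> I"
      using g(1) gJ by (simp add: L_def)
    ultimately have "t = 0"
      using csubspace_scale_cancel[OF I'] by blast
    with mem f(1) show False by simp
  qed
  have punctual: "add_line L (f + const_poly t * (g - f)) \<in> punctual_hilb k" (is "?I \<in> _") for t
  proof -
    let ?f = "f + const_poly t * (g - f)"
    have hyp: "hyperplane L ?I"
      using notin by (auto simp: hyperplane_def)
    have "is_ideal ?I"
    proof (rule is_ideal_add_line[OF idL])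
      fix r
      have "(r - const_poly (eval_poly (\<lambda>_. 0) r)) * ?f =
        const_poly (1 - t) * ((r - const_poly (eval_poly (\<lambda>_. 0) r)) * f) +
        const_poly t * ((r - const_poly (eval_poly (\<lambda>_. 0) r)) * g)"
        unfolding fg by (simp add: algebra_simps)
      also have "\<dots> \<in> L"
        by (intro csubspace_add[OF L'] csubspace_scale[OF L']
            hyperplane_at_origin[OF idL idI hypI zlL fI]
            hyperplane_at_origin[OF idL idJ hypJ zlL gJ])
      finally show "(r - const_poly (eval_poly (\<lambda>_. 0) r)) * ?f \<in> L" .
    qed
    moreover have "has_colength ?I k"
      using has_colength_of_hyperplane[OF L' hyp] L by (simp add: punctual_hilb_iff)
    moreover have "zero_locus ?I = {\<lambda>_. 0}"
    proof
      have "?f \<in> origin_ideal"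
        using punctual_hilb_subset_origin[OF I(1)] punctual_hilb_subset_origin[OF J(1)] fI gJ
        by (auto simp: subset_iff)
      then have "?I \<subseteq> origin_ideal"
        using add_line_subset[OF is_ideal_csubspace[OF is_ideal_origin_ideal]
            punctual_hilb_subset_origin[OF L]] by blast
      then show "{\<lambda>_. 0} \<subseteq> zero_locus ?I"
        by (auto simp: zero_locus_def)
      show "zero_locus ?I \<subseteq> {\<lambda>_. 0}"
        using zero_locus_antimono[OF add_line_superset[of L ?f]] zlL by simp
    qed
    ultimately show ?thesis
      by (simp add: punctual_hilb_iff)
  qed
  show ?thesis
    using that[OF L' notin punctual] f(2) g(2) by simp
qed

section \<open>The space of closed points\<close>

text \<open>Every ideal lies in a chart by \<open>monomial_basis_mod\<close>; the constant 1 makes the whole chart a basic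
  open set.\<close>

lemma topspace_hilb_zariski: "punctual_hilb k \<subseteq> topspace (hilb_zariski k)"
proof
  fix I :: "'n::finite mpoly set"
  assume I: "I \<in> punctual_hilb k"
  then have hilb: "I \<in> hilb k" and sub: "csubspace I"
    using is_ideal_csubspace by (auto simp: punctual_hilb_def hilb_def)
  from hilb obtain M where M: "finite M" "card M = k" "basis_mod I (mon ` M)"
    using monomial_basis_mod[OF sub] unfolding hilb_def has_colength_def by blast
  have "I \<in> {I \<in> chart k M. eval_poly (chart_coord M I) 1 \<noteq> 0}"
    using hilb M by (simp add: chart_def)
  with M show "I \<in> topspace (hilb_zariski k)"
    unfolding hilb_zariski_def topology_generated_by_topspace by blast
qed

text \<open>Otherwise the members of the pencil in U and those in V would be two disjoint cofinite sets of
  parameters.\<close>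

lemma adjacent_not_separated:
  assumes adj: "(I, J) \<in> adjacent k"
    and U: "openin (hilb_zariski k) U" and V: "openin (hilb_zariski k) V"
    and cover: "punctual_hilb k \<subseteq> U \<union> V" and disj: "punctual_hilb k \<inter> U \<inter> V = {}"
    and I: "I \<in> U"
  shows "J \<in> U"
proof (rule ccontr)
  assume J: "J \<notin> U"
  with I have "I \<noteq> J" by blast
  then obtain L f h where L: "csubspace L" "\<And>t. f + const_poly t * h \<notin> L"
    and ph: "\<And>t. add_line L (f + const_poly t * h) \<in> punctual_hilb k"
    and eq: "add_line L (f + const_poly 0 * h) = I" "add_line L (f + const_poly 1 * h) = J"
    using adjacent_pencil[OF adj] by metis
  let ?\<gamma> = "\<lambda>t. add_line L (f + const_poly t * h)"
  have hilb: "?\<gamma> t \<in> hilb k" for t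
    using ph by (simp add: punctual_hilb_def)
  have "J \<in> V"
    using ph[of 1] eq(2) cover J by auto
  have "?\<gamma> 0 \<in> U" "?\<gamma> 1 \<in> V"
    using I \<open>J \<in> V\<close> eq by simp_all
  then have "finite {t. ?\<gamma> t \<notin> U}" "finite {t. ?\<gamma> t \<notin> V}"
    using pencil_continuous[OF L hilb U] pencil_continuous[OF L hilb V] by blast+
  then have "finite ({t. ?\<gamma> t \<notin> U} \<union> {t. ?\<gamma> t \<notin> V})" by simp
  then obtain t where "t \<notin> {t. ?\<gamma> t \<notin> U} \<union> {t. ?\<gamma> t \<notin> V}"
    using ex_new_if_finite[OF infinite_UNIV_char_0] by blast
  with ph[of t] disj show False by blast
qed

lemma connected_punctual_hilb:
  "connected_space (subtopology (hilb_zariski (Suc k)) (punctual_hilb (Suc k)))"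
proof -
  let ?k = "Suc k"
  have not_separated: False
    if U: "openin (hilb_zariski ?k) U" and V: "openin (hilb_zariski ?k) V"
      and cover: "punctual_hilb ?k \<subseteq> U \<union> V" and disj: "punctual_hilb ?k \<inter> U \<inter> V = {}"
      and I: "I \<in> punctual_hilb ?k \<inter> U" and J: "J \<in> punctual_hilb ?k \<inter> V" for U V I J
  proof -
    have "(I, J) \<in> (adjacent ?k)\<^sup>*"
      using adjacent_chain I J by blast
    then have "J \<in> U"
    proof induction
      case base
      show ?case using I by simp
    next
      case (step K K')
      then show ?case
        using adjacent_not_separated[OF _ U V cover disj] by simp
    qed
    with J disj show False by blast
  qed
  have top: "topspace (subtopology (hilb_zariski ?k) (punctual_hilb ?k)) = punctual_hilb ?k"
    using topspace_hilb_zariski by auto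
  show ?thesis
    unfolding connected_space_def openin_subtopology top
  proof (intro notI, elim exE conjE)
    fix E F U V
    assume "openin (hilb_zariski ?k) U" "openin (hilb_zariski ?k) V"
      and E: "E = U \<inter> punctual_hilb ?k" and F: "F = V \<inter> punctual_hilb ?k"
      and "punctual_hilb ?k \<subseteq> E \<union> F" "E \<inter> F = {}" "E \<noteq> {}" "F \<noteq> {}"
    moreover from \<open>E \<noteq> {}\<close> \<open>F \<noteq> {}\<close> obtain I J where "I \<in> E" "J \<in> F" by auto
    ultimately show False
      by (intro not_separated[of U V I J]) auto
  qed
qed

text \<open>The ideal of a multiple point on a coordinate axis, (x_v^k) + (x_w : w \<noteq> v), described by
  restriction to the axis. Membership is divisibility of the restriction by t^k, so the ideal
  properties reduce to those of polynomials in one variable.\<close>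

definition axis_ideal :: "'v \<Rightarrow> nat \<Rightarrow> 'v mpoly set" where
  "axis_ideal v k = {f. \<exists>q. \<forall>t. eval_poly (\<lambda>w. if w = v then t else 0) f = t ^ k * poly q t}"

text \<open>Restriction to the axis identifies the quotient with polynomials in one variable modulo t^k, so
  the powers of x_v below k form a basis.\<close>

lemma axis_ideal_punctual:
  fixes v :: "'n::finite"
  shows "axis_ideal v (Suc k) \<in> punctual_hilb (Suc k)"
proof -
  let ?k = "Suc k" and ?I = "axis_ideal v (Suc k)"
  let ?e = "\<lambda>t f. eval_poly (\<lambda>w. if w = v then t else 0) f"
  define x where "x j = mon (Poly_Mapping.single v j)" for j
  have restrict: "\<exists>q. \<forall>t. ?e t f = poly q t" for f
    using eval_poly_along_curve[of "\<lambda>w. if w = v then [:0, 1:] else 0" f]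
    by (simp add: if_distrib[of "\<lambda>p. poly p _"] cong: if_cong)
  have ideal: "is_ideal ?I"
    unfolding is_ideal_iff
  proof (intro conjI ballI allI)
    show "0 \<in> ?I"
      by (auto simp: axis_ideal_def intro: exI[of _ 0])
    fix f assume "f \<in> ?I"
    then obtain q where q: "\<And>t. ?e t f = t ^ ?k * poly q t"
      by (auto simp: axis_ideal_def)
    show "f + g \<in> ?I" if g: "g \<in> ?I" for g
    proof -
      obtain q' where "\<And>t. ?e t g = t ^ ?k * poly q' t"
        using g by (auto simp: axis_ideal_def)
      with q have "\<forall>t. ?e t (f + g) = t ^ ?k * poly (q + q') t"
        by (simp add: distrib_left)
      then show ?thesis
        unfolding axis_ideal_def by blast
    qed
    show "h * f \<in> ?I" for h
    proof -
      obtain q' where "\<forall>t. ?e t h = poly q' t"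
        using restrict by blast
      with q have "\<forall>t. ?e t (h * f) = t ^ ?k * poly (q' * q) t"
        by (simp add: mult.left_commute)
      then show ?thesis
        unfolding axis_ideal_def by blast
    qed
  qed
  have inj: "inj x"
    unfolding x_def mon_def
    by (intro injI) (metis keys_single lookup_single_eq singleton_inject zero_neq_one)
  define B where "B = x ` {..<?k}"
  have fin: "finite B" and card: "card B = ?k"
    unfolding B_def using inj by (simp_all add: card_image inj_on_subset)
  have eval: "?e t (lincomb B a) = poly (\<Sum>j<?k. monom (a (x j)) j) t" for a t
    unfolding lincomb_def B_def using inj
    by (simp add: sum.reindex inj_on_subset poly_sum poly_monom del: sum.lessThan_Suc)
       (simp add: x_def)
  have "\<exists>a. f - lincomb B a \<in> ?I" for f
  proof -
    obtain q where q: "\<forall>t. ?e t f = poly q t"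
      using restrict by blast
    define a where "a p = coeff q (inv x p)" for p
    have shift: "q - (\<Sum>j<?k. monom (a (x j)) j) = monom 1 ?k * poly_shift ?k q"
      using inj by (intro poly_eqI)
        (simp add: coeff_sum coeff_monom_mult coeff_poly_shift a_def del: sum.lessThan_Suc)
    have "?e t (f - lincomb B a) = poly (q - (\<Sum>j<?k. monom (a (x j)) j)) t" for t
      using q by (simp only: eval_poly_diff eval poly_diff)
    then have "\<forall>t. ?e t (f - lincomb B a) = t ^ ?k * poly (poly_shift ?k q) t"
      unfolding shift by (simp add: poly_monom)
    then show ?thesis
      unfolding axis_ideal_def by blast
  qed
  moreover have "\<forall>b\<in>B. a b = 0" if a: "lincomb B a \<in> ?I" for a
  proof -
    obtain q where "\<forall>t. ?e t (lincomb B a) = t ^ ?k * poly q t"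
      using a unfolding axis_ideal_def by blast
    then have "poly (\<Sum>j<?k. monom (a (x j)) j) = poly (monom 1 ?k * q)"
      unfolding eval by (simp add: poly_monom fun_eq_iff)
    then have eq: "(\<Sum>j<?k. monom (a (x j)) j) = monom 1 ?k * q"
      by (simp only: poly_eq_poly_eq_iff)
    have "a (x j) = 0" if "j < ?k" for j
      using arg_cong[OF eq, of "\<lambda>p. coeff p j"] that
      by (simp add: coeff_sum coeff_monom_mult del: sum.lessThan_Suc)
    then show ?thesis
      by (auto simp: B_def)
  qed
  ultimately have "has_colength ?I ?k"
    using fin card unfolding has_colength_def basis_mod_iff[OF is_ideal_csubspace[OF ideal]] by blast
  moreover have "zero_locus ?I = {\<lambda>_. 0}"
  proof
    have "eval_poly (\<lambda>_. 0) f = 0" if f: "f \<in> ?I" for f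
    proof -
      obtain q where "\<forall>t. ?e t f = t ^ ?k * poly q t"
        using f unfolding axis_ideal_def by blast
      from spec[OF this, of 0] show ?thesis by simp
    qed
    then show "{\<lambda>_. 0} \<subseteq> zero_locus ?I"
      by (simp add: zero_locus_def)
    show "zero_locus ?I \<subseteq> {\<lambda>_. 0}"
    proof
      fix a assume a: "a \<in> zero_locus ?I"
      have "a w = 0" for w
      proof (cases "w = v")
        case True
        have "x ?k \<in> ?I"
          unfolding axis_ideal_def x_def by (auto intro: exI[of _ 1])
        then have "a v ^ ?k = 0"
          using a by (auto simp: zero_locus_def x_def simp del: power_Suc)
        with True show ?thesis by auto
      next
        case False
        then have "var w \<in> ?I"
          unfolding axis_ideal_def by (auto intro: exI[of _ 0])
        then have "eval_poly a (var w) = 0"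
          using a unfolding zero_locus_def by blast
        then show ?thesis by simp
      qed
      then show "a \<in> {\<lambda>_. 0}" by auto
    qed
  qed
  ultimately show ?thesis
    using ideal by (simp add: punctual_hilb_iff)
qed

section \<open>From closed points to all points of the scheme\<close>

lemma irreducible_closedin_meets_Int:
  assumes Y: "irreducible_closedin X Y" and U: "openin X U" and V: "openin X V"
    and meets: "Y \<inter> U \<noteq> {}" "Y \<inter> V \<noteq> {}"
  shows "Y \<inter> (U \<inter> V) \<noteq> {}"
proof
  assume "Y \<inter> (U \<inter> V) = {}"
  then have "Y \<subseteq> (topspace X - U) \<union> (topspace X - V)"
    using Y closedin_subset by (fastforce simp: irreducible_closedin_def)
  then have "Y \<subseteq> topspace X - U \<or> Y \<subseteq> topspace X - V"
    using Y U V unfolding irreducible_closedin_def by blast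
  with meets show False by blast
qed

text \<open>The sets in the generating family already form the whole topology: they are closed under finite
  intersections by irreducibility, and under unions by construction.\<close>

lemma openin_scheme_space:
  assumes "openin (scheme_space X) E"
  shows "\<exists>U. openin X U \<and> E = {Y. irreducible_closedin X Y \<and> Y \<inter> U \<noteq> {}}"
proof -
  define meeting where "meeting U = {Y. irreducible_closedin X Y \<and> Y \<inter> U \<noteq> {}}" for U
  have "generate_topology_on {meeting U | U. openin X U} E"
    using assms unfolding scheme_space_def meeting_def by (rule openin_topology_generated_by)
  then have "\<exists>U. openin X U \<and> E = meeting U"
  proof induction
    case Empty
    have "{} = meeting {}"
      by (simp add: meeting_def)
    then show ?case
      using openin_empty by blast
  next
    case (Int E F)
    then obtain U V where U: "openin X U" "E = meeting U" and V: "openin X V" "F = meeting V"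
      by auto
    then have "E \<inter> F = meeting (U \<inter> V)"
      using irreducible_closedin_meets_Int[OF _ U(1) V(1)] by (auto simp: meeting_def)
    moreover have "openin X (U \<inter> V)"
      using U(1) V(1) by (rule openin_Int)
    ultimately show ?case by auto
  next
    case (UN \<E>)
    let ?\<U> = "{U. openin X U \<and> meeting U \<in> \<E>}"
    have "\<Union>\<E> = (\<Union>U\<in>?\<U>. meeting U)"
    proof
      show "\<Union>\<E> \<subseteq> (\<Union>U\<in>?\<U>. meeting U)"
      proof
        fix Y assume "Y \<in> \<Union>\<E>"
        then obtain E where "E \<in> \<E>" "Y \<in> E" ..
        moreover from UN.IH[OF this(1)] obtain U where "openin X U" "E = meeting U" by auto
        ultimately show "Y \<in> (\<Union>U\<in>?\<U>. meeting U)" by auto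
      qed
    qed auto
    also have "\<dots> = meeting (\<Union>?\<U>)"
      by (auto simp: meeting_def)
    finally have "\<Union>\<E> = meeting (\<Union>?\<U>)" .
    moreover have "openin X (\<Union>?\<U>)"
      by (rule openin_Union) simp
    ultimately show ?case by auto
  next
    case (Basis E)
    then show ?case by auto
  qed
  then show ?thesis
    by (simp add: meeting_def)
qed

lemma irreducible_closure_of_point:
  assumes "x \<in> topspace X"
  shows "irreducible_closedin X (X closure_of {x})"
proof -
  have x: "x \<in> X closure_of {x}"
    using assms closure_of_subset[of "{x}" X] by simp
  have "X closure_of {x} \<subseteq> A" if "closedin X A" "x \<in> A" for A
    using that by (intro closure_of_minimal) simp_all
  with x show ?thesis
    unfolding irreducible_closedin_def by (metis Un_iff closedin_closure_of empty_iff subset_iff)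
qed

lemma closure_of_point_meets_iff:
  assumes "x \<in> topspace X" "openin X U"
  shows "X closure_of {x} \<inter> U \<noteq> {} \<longleftrightarrow> x \<in> U"
  using openin_Int_closure_of_eq_empty[OF assms(2), of "{x}"] by (auto simp: Int_commute)

lemma closure_of_point_in_scheme_space:
  assumes "x \<in> topspace X"
  shows "X closure_of {x} \<in> topspace (scheme_space X)"
proof -
  have "X closure_of {x} \<in> {Y. irreducible_closedin X Y \<and> Y \<inter> topspace X \<noteq> {}}"
    using irreducible_closure_of_point[OF assms] closure_of_point_meets_iff[OF assms, of "topspace X"] assms
    by simp
  then show ?thesis
    unfolding scheme_space_def topology_generated_by_topspace by blast
qed

text \<open>The closure of a point x meets an open set U exactly if x is in U. So a separation of the points of the
  scheme comes from open sets of X that separate X.\<close>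

lemma connected_scheme_space:
  assumes "connected_space X"
  shows "connected_space (scheme_space X)"
  unfolding connected_space_def
proof (intro notI, elim exE conjE)
  fix E1 E2
  assume E: "openin (scheme_space X) E1" "openin (scheme_space X) E2"
    and cover: "topspace (scheme_space X) \<subseteq> E1 \<union> E2" and disj: "E1 \<inter> E2 = {}"
    and ne: "E1 \<noteq> {}" "E2 \<noteq> {}"
  obtain U1 where U1: "openin X U1" "E1 = {Y. irreducible_closedin X Y \<and> Y \<inter> U1 \<noteq> {}}"
    using openin_scheme_space[OF E(1)] by blast
  obtain U2 where U2: "openin X U2" "E2 = {Y. irreducible_closedin X Y \<and> Y \<inter> U2 \<noteq> {}}"
    using openin_scheme_space[OF E(2)] by blast
  have point: "X closure_of {x} \<in> E1 \<longleftrightarrow> x \<in> U1" "X closure_of {x} \<in> E2 \<longleftrightarrow> x \<in> U2"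
    if "x \<in> topspace X" for x
    using irreducible_closure_of_point[OF that] closure_of_point_meets_iff[OF that] U1 U2 by simp_all
  have "topspace X \<subseteq> U1 \<union> U2"
  proof
    fix x assume x: "x \<in> topspace X"
    then have "X closure_of {x} \<in> E1 \<union> E2"
      using closure_of_point_in_scheme_space cover by (rule_tac subsetD)
    then show "x \<in> U1 \<union> U2"
      by (simp add: point[OF x])
  qed
  moreover have "U1 \<inter> U2 = {}"
  proof (rule ccontr)
    assume "U1 \<inter> U2 \<noteq> {}"
    then obtain x where x: "x \<in> U1" "x \<in> U2" by auto
    then have "x \<in> topspace X"
      using openin_subset[OF U1(1)] by auto
    from point[OF this] x have "X closure_of {x} \<in> E1 \<inter> E2" by simp
    with disj show False by simp
  qed
  moreover have "U1 \<noteq> {}" "U2 \<noteq> {}"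
    using ne U1(2) U2(2) by auto
  ultimately show False
    using assms U1(1) U2(1) unfolding connected_space_def by auto
qed

theorem theorem1p2:
  fixes k :: nat
  assumes "k \<ge> 1"
  shows "topspace (punctual_hilbert_scheme k :: 'n::finite mpoly set set topology) \<noteq> {} \<and>
         connected_space (punctual_hilbert_scheme k :: 'n::finite mpoly set set topology)"
proof -
  obtain k' where k: "k = Suc k'"
    using assms by (cases k) auto
  let ?X = "subtopology (hilb_zariski k) (punctual_hilb k) :: 'n mpoly set topology"
  have "axis_ideal undefined k \<in> topspace ?X"
    using axis_ideal_punctual[of undefined k'] topspace_hilb_zariski[of k] k by auto
  then have "topspace (scheme_space ?X) \<noteq> {}"
    using closure_of_point_in_scheme_space by fast
  moreover have "connected_space (scheme_space ?X)"
    using connected_scheme_space connected_punctual_hilb k by blast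
  ultimately show ?thesis
    unfolding punctual_hilbert_scheme_def by simp
qed

end
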